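(* Let $\mathcal C$ be a $K$-linear, Krull-Schmidt, Hom-finite $2$-Calabi-Yau triangulated category with a basic cluster tilting object $T=\bigoplus_{i=1}^nT_i$, and let $U$ be a rigid object in $\mathcal C$. Then $\mathcal T_U(T)$ is a basic cluster tilting object in $\mathcal C$.
   Context: $K$ is a field and $[1]$ denotes the shift functor. $\mathcal C$ is $2$-Calabi-Yau if there are bifunctorial isomorphisms $\mathrm{Hom}_{\mathcal C}(X,Y)\cong D\,\mathrm{Hom}_{\mathcal C}(Y,X[2])$, $D=\mathrm{Hom}_K(-,K)$. For an object $X$, $\mathrm{add}(X)$ is the full subcategory of direct summands of finite direct sums of copies of $X$, and $X^\flat$ is the basic object (unique up to isomorphism; basic means that its indecomposable direct summands are pairwise non-isomorphic) with $\mathrm{add}(X^\flat)=\mathrm{add}(X)$. An object $T$ is cluster tilting if $\mathrm{add}(T)=\{X\in\mathcal C\mid \mathrm{Hom}_{\mathcal C}(T,X[1])=0\}$; an object $U$ is rigid if $\mathrm{Hom}_{\mathcal C}(U,U[1])=0$. Co-Bongartz completion: for objects $U,W$ take a triangle $W[-1]\xrightarrow{f}U'\to X_U\to W$, where $f$ is a left minimal $\mathrm{add}(U)$-approximation of $W[-1]$ (i.e. $U'\in\mathrm{add}(U)$, every morphism from $W[-1]$ to an object of $\mathrm{add}(U)$ factors through $f$, and $f$ has no direct summand of the form $0\to U_1$ with $U_1\ne0$). The co-Bongartz completion of $U$ with respect to $W$ is $\mathcal T_U(W):=(U\oplus X_U)^\flat$. *)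

theory Defs
  imports "HOL-Algebra.Module"
begin

section \<open>Linear algebra over a field\<close>

definition linear_maps ::
  "('k, 'r) ring_scheme \<Rightarrow> ('k, 'a, 'p) module_scheme \<Rightarrow> ('k, 'b, 'q) module_scheme \<Rightarrow> ('a \<Rightarrow> 'b) set"
  where "linear_maps K V W =
    {\<phi> \<in> hom (add_monoid V) (add_monoid W).
       \<forall>a\<in>carrier K. \<forall>x\<in>carrier V. \<phi> (a \<odot>\<^bsub>V\<^esub> x) = a \<odot>\<^bsub>W\<^esub> \<phi> x}"

definition linear_isos ::
  "('k, 'r) ring_scheme \<Rightarrow> ('k, 'a, 'p) module_scheme \<Rightarrow> ('k, 'b, 'q) module_scheme \<Rightarrow> ('a \<Rightarrow> 'b) set"
  where "linear_isos K V W = {\<phi> \<in> linear_maps K V W. bij_betw \<phi> (carrier V) (carrier W)}"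

definition finite_dimensional ::
  "('k, 'r) ring_scheme \<Rightarrow> ('k, 'a, 'p) module_scheme \<Rightarrow> bool"
  where "finite_dimensional K V \<longleftrightarrow>
    (\<exists>B. finite B \<and> B \<subseteq> carrier V \<and>
       (\<forall>v\<in>carrier V. \<exists>c\<in>B \<rightarrow> carrier K. v = (\<Oplus>\<^bsub>V\<^esub>b\<in>B. c b \<odot>\<^bsub>V\<^esub> b)))"

text \<open>The record type of modules extends that of rings; the fields \<open>mult\<close> and \<open>one\<close>
  play no role for modules.\<close>

definition self_module :: "('k, 'r) ring_scheme \<Rightarrow> ('k, 'k) module"
  where "self_module K =
    \<lparr>carrier = carrier K, monoid.mult = monoid.mult K, one = one K,
     zero = zero K, add = add K, smult = monoid.mult K\<rparr>"

text \<open>Functionals are made extensional, so that each linear map from \<open>V\<close> to \<open>K\<close> is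
  represented by exactly one function.\<close>

definition dual_module ::
  "('k, 'r) ring_scheme \<Rightarrow> ('k, 'a, 'p) module_scheme \<Rightarrow> ('k, 'a \<Rightarrow> 'k) module"
  where "dual_module K V =
    \<lparr>carrier = linear_maps K V (self_module K) \<inter> extensional (carrier V),
     monoid.mult = undefined, one = undefined,
     zero = (\<lambda>x\<in>carrier V. \<zero>\<^bsub>K\<^esub>),
     add = (\<lambda>\<phi> \<psi>. \<lambda>x\<in>carrier V. \<phi> x \<oplus>\<^bsub>K\<^esub> \<psi> x),
     smult = (\<lambda>a \<phi>. \<lambda>x\<in>carrier V. a \<otimes>\<^bsub>K\<^esub> \<phi> x)\<rparr>"

definition local_ring :: "('a, 'r) ring_scheme \<Rightarrow> bool"
  where "local_ring R \<longleftrightarrow> ring R \<and> \<one>\<^bsub>R\<^esub> \<noteq> \<zero>\<^bsub>R\<^esub> \<and>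
    (\<forall>a\<in>carrier R - Units R. \<forall>b\<in>carrier R - Units R. a \<oplus>\<^bsub>R\<^esub> b \<notin> Units R)"


section \<open>Linear categories\<close>

record ('k, 'o, 'm) lin_cat =
  Obj :: "'o set"
  Hom :: "'o \<Rightarrow> 'o \<Rightarrow> ('k, 'm) module"
  cmp :: "'m \<Rightarrow> 'm \<Rightarrow> 'm" (infixl \<open>\<cdot>\<index>\<close> 70)
  idn :: "'o \<Rightarrow> 'm"

abbreviation Mor :: "('k, 'o, 'm, 'z) lin_cat_scheme \<Rightarrow> 'o \<Rightarrow> 'o \<Rightarrow> 'm set"
  where "Mor C X Y \<equiv> carrier (Hom C X Y)"

text \<open>Composition is written from right to left: \<open>g \<cdot> f\<close> is \<open>f\<close> followed by \<open>g\<close>.\<close>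

locale linear_category =
  fixes K :: "('k, 'r) ring_scheme" and C :: "('k, 'o, 'm, 'z) lin_cat_scheme" (structure)
  assumes field_K: "field K"
    and Hom_module: "\<lbrakk>X \<in> Obj C; Y \<in> Obj C\<rbrakk> \<Longrightarrow> module K (Hom C X Y)"
    and Hom_disjoint:
      "\<lbrakk>X \<in> Obj C; Y \<in> Obj C; X' \<in> Obj C; Y' \<in> Obj C; f \<in> Mor C X Y; f \<in> Mor C X' Y'\<rbrakk>
       \<Longrightarrow> X = X' \<and> Y = Y'"
    and idn_closed: "X \<in> Obj C \<Longrightarrow> idn C X \<in> Mor C X X"
    and cmp_closed:
      "\<lbrakk>X \<in> Obj C; Y \<in> Obj C; Z \<in> Obj C; f \<in> Mor C X Y; g \<in> Mor C Y Z\<rbrakk> \<Longrightarrow> g \<cdot> f \<in> Mor C X Z"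
    and idn_left: "\<lbrakk>X \<in> Obj C; Y \<in> Obj C; f \<in> Mor C X Y\<rbrakk> \<Longrightarrow> idn C Y \<cdot> f = f"
    and idn_right: "\<lbrakk>X \<in> Obj C; Y \<in> Obj C; f \<in> Mor C X Y\<rbrakk> \<Longrightarrow> f \<cdot> idn C X = f"
    and cmp_assoc:
      "\<lbrakk>W \<in> Obj C; X \<in> Obj C; Y \<in> Obj C; Z \<in> Obj C;
        f \<in> Mor C W X; g \<in> Mor C X Y; h \<in> Mor C Y Z\<rbrakk> \<Longrightarrow> (h \<cdot> g) \<cdot> f = h \<cdot> (g \<cdot> f)"
    and cmp_linear_left:
      "\<lbrakk>X \<in> Obj C; Y \<in> Obj C; Z \<in> Obj C; f \<in> Mor C X Y\<rbrakk>
       \<Longrightarrow> (\<lambda>g. g \<cdot> f) \<in> linear_maps K (Hom C Y Z) (Hom C X Z)"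
    and cmp_linear_right:
      "\<lbrakk>X \<in> Obj C; Y \<in> Obj C; Z \<in> Obj C; g \<in> Mor C Y Z\<rbrakk>
       \<Longrightarrow> (\<lambda>f. g \<cdot> f) \<in> linear_maps K (Hom C X Y) (Hom C X Z)"

definition isomorphism :: "('k, 'o, 'm, 'z) lin_cat_scheme \<Rightarrow> 'o \<Rightarrow> 'o \<Rightarrow> 'm \<Rightarrow> bool"
  where "isomorphism C X Y f \<longleftrightarrow> f \<in> Mor C X Y \<and>
    (\<exists>g\<in>Mor C Y X. g \<cdot>\<^bsub>C\<^esub> f = idn C X \<and> f \<cdot>\<^bsub>C\<^esub> g = idn C Y)"

definition isomorphic :: "('k, 'o, 'm, 'z) lin_cat_scheme \<Rightarrow> 'o \<Rightarrow> 'o \<Rightarrow> bool"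
  where "isomorphic C X Y \<longleftrightarrow> (\<exists>f. isomorphism C X Y f)"

definition End_ring :: "('k, 'o, 'm, 'z) lin_cat_scheme \<Rightarrow> 'o \<Rightarrow> ('k, 'm) module"
  where "End_ring C X = (Hom C X X)\<lparr>monoid.mult := cmp C, one := idn C X\<rparr>"

definition zero_object :: "('k, 'o, 'm, 'z) lin_cat_scheme \<Rightarrow> 'o \<Rightarrow> bool"
  where "zero_object C X \<longleftrightarrow> X \<in> Obj C \<and>
    (\<forall>Y\<in>Obj C. (\<exists>!f. f \<in> Mor C X Y) \<and> (\<exists>!f. f \<in> Mor C Y X))"

text \<open>\<open>S\<close> is a direct sum (biproduct) of the objects in the list \<open>Xs\<close>, with inclusions \<open>\<iota> i\<close>
  and projections \<open>\<pi> i\<close>. For the empty list the last condition reads \<open>0 = id\<close>,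
  that is, \<open>S\<close> is a zero object.\<close>

definition biproduct ::
  "('k, 'o, 'm, 'z) lin_cat_scheme \<Rightarrow> 'o list \<Rightarrow> 'o \<Rightarrow> (nat \<Rightarrow> 'm) \<Rightarrow> (nat \<Rightarrow> 'm) \<Rightarrow> bool"
  where "biproduct C Xs S \<iota> \<pi> \<longleftrightarrow>
    set Xs \<subseteq> Obj C \<and> S \<in> Obj C \<and>
    (\<forall>i<length Xs. \<iota> i \<in> Mor C (Xs ! i) S \<and> \<pi> i \<in> Mor C S (Xs ! i)) \<and>
    (\<forall>i<length Xs. \<forall>j<length Xs.
       \<pi> j \<cdot>\<^bsub>C\<^esub> \<iota> i = (if i = j then idn C (Xs ! i) else \<zero>\<^bsub>Hom C (Xs ! i) (Xs ! j)\<^esub>)) \<and>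
    (\<Oplus>\<^bsub>Hom C S S\<^esub>i\<in>{..<length Xs}. \<iota> i \<cdot>\<^bsub>C\<^esub> \<pi> i) = idn C S"

definition direct_sum :: "('k, 'o, 'm, 'z) lin_cat_scheme \<Rightarrow> 'o list \<Rightarrow> 'o \<Rightarrow> bool"
  where "direct_sum C Xs S \<longleftrightarrow> (\<exists>\<iota> \<pi>. biproduct C Xs S \<iota> \<pi>)"

locale additive_linear_category = linear_category +
  assumes direct_sum_exists: "set Xs \<subseteq> Obj C \<Longrightarrow> \<exists>S. direct_sum C Xs S"

definition Hom_finite ::
  "('k, 'r) ring_scheme \<Rightarrow> ('k, 'o, 'm, 'z) lin_cat_scheme \<Rightarrow> bool"
  where "Hom_finite K C \<longleftrightarrow> (\<forall>X\<in>Obj C. \<forall>Y\<in>Obj C. finite_dimensional K (Hom C X Y))"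

definition Krull_Schmidt :: "('k, 'o, 'm, 'z) lin_cat_scheme \<Rightarrow> bool"
  where "Krull_Schmidt C \<longleftrightarrow>
    (\<forall>X\<in>Obj C. \<exists>Xs. direct_sum C Xs X \<and> (\<forall>Y\<in>set Xs. local_ring (End_ring C Y)))"

definition indecomposable :: "('k, 'o, 'm, 'z) lin_cat_scheme \<Rightarrow> 'o \<Rightarrow> bool"
  where "indecomposable C X \<longleftrightarrow> X \<in> Obj C \<and> \<not> zero_object C X \<and>
    (\<forall>Y Z. direct_sum C [Y, Z] X \<longrightarrow> zero_object C Y \<or> zero_object C Z)"

definition direct_summand :: "('k, 'o, 'm, 'z) lin_cat_scheme \<Rightarrow> 'o \<Rightarrow> 'o \<Rightarrow> bool"
  where "direct_summand C Y X \<longleftrightarrow> (\<exists>Z. direct_sum C [Y, Z] X)"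

text \<open>Full subcategories are given by their sets of objects.\<close>

definition add_closure :: "('k, 'o, 'm, 'z) lin_cat_scheme \<Rightarrow> 'o \<Rightarrow> 'o set"
  where "add_closure C X =
    {Y. \<exists>n S. direct_sum C (replicate n X) S \<and> direct_summand C Y S}"

text \<open>The second argument is a list \<open>[X\<^sub>1, \<dots>, X\<^sub>n]\<close> of pairwise non-isomorphic
  indecomposable objects with direct sum \<open>X\<close>. In a Krull-Schmidt category the
  indecomposable summands are unique up to isomorphism and order, so that one such
  decomposition suffices for being basic.\<close>

definition basic_decomposition :: "('k, 'o, 'm, 'z) lin_cat_scheme \<Rightarrow> 'o list \<Rightarrow> 'o \<Rightarrow> bool"
  where "basic_decomposition C Xs X \<longleftrightarrow> direct_sum C Xs X \<and>
    (\<forall>Y\<in>set Xs. indecomposable C Y) \<and>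
    (\<forall>i<length Xs. \<forall>j<length Xs. i \<noteq> j \<longrightarrow> \<not> isomorphic C (Xs ! i) (Xs ! j))"

definition basic :: "('k, 'o, 'm, 'z) lin_cat_scheme \<Rightarrow> 'o \<Rightarrow> bool"
  where "basic C X \<longleftrightarrow> (\<exists>Xs. basic_decomposition C Xs X)"

text \<open>\<open>V\<close> is a representative of the isomorphism class of \<open>X\<^sup>\<flat>\<close>.\<close>

definition basic_version :: "('k, 'o, 'm, 'z) lin_cat_scheme \<Rightarrow> 'o \<Rightarrow> 'o \<Rightarrow> bool"
  where "basic_version C X V \<longleftrightarrow> basic C V \<and> add_closure C V = add_closure C X"

definition left_approximation ::
  "('k, 'o, 'm, 'z) lin_cat_scheme \<Rightarrow> 'o \<Rightarrow> 'o \<Rightarrow> 'o \<Rightarrow> 'm \<Rightarrow> bool"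
  where "left_approximation C U A B f \<longleftrightarrow> B \<in> add_closure C U \<and> f \<in> Mor C A B \<and>
    (\<forall>B'\<in>add_closure C U. \<forall>g\<in>Mor C A B'. \<exists>h\<in>Mor C B B'. g = h \<cdot>\<^bsub>C\<^esub> f)"

text \<open>\<open>f\<^sub>1 : A\<^sub>1 \<rightarrow> B\<^sub>1\<close> is a direct summand of \<open>f : A \<rightarrow> B\<close>
  in the category of morphisms.\<close>

definition morphism_summand ::
  "('k, 'o, 'm, 'z) lin_cat_scheme \<Rightarrow> 'o \<Rightarrow> 'o \<Rightarrow> 'm \<Rightarrow> 'o \<Rightarrow> 'o \<Rightarrow> 'm \<Rightarrow> bool"
  where "morphism_summand C A\<^sub>1 B\<^sub>1 f\<^sub>1 A B f \<longleftrightarrow>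
    (\<exists>A\<^sub>2 B\<^sub>2 f\<^sub>2 \<iota> \<pi> \<iota>' \<pi>'.
       biproduct C [A\<^sub>1, A\<^sub>2] A \<iota> \<pi> \<and> biproduct C [B\<^sub>1, B\<^sub>2] B \<iota>' \<pi>' \<and>
       f\<^sub>1 \<in> Mor C A\<^sub>1 B\<^sub>1 \<and> f\<^sub>2 \<in> Mor C A\<^sub>2 B\<^sub>2 \<and>
       f = (\<iota>' 0 \<cdot>\<^bsub>C\<^esub> f\<^sub>1 \<cdot>\<^bsub>C\<^esub> \<pi> 0) \<oplus>\<^bsub>Hom C A B\<^esub> (\<iota>' 1 \<cdot>\<^bsub>C\<^esub> f\<^sub>2 \<cdot>\<^bsub>C\<^esub> \<pi> 1))"

definition left_minimal ::
  "('k, 'o, 'm, 'z) lin_cat_scheme \<Rightarrow> 'o \<Rightarrow> 'o \<Rightarrow> 'm \<Rightarrow> bool"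
  where "left_minimal C A B f \<longleftrightarrow>
    \<not> (\<exists>Z B\<^sub>1. zero_object C Z \<and> B\<^sub>1 \<in> Obj C \<and> \<not> zero_object C B\<^sub>1 \<and>
          morphism_summand C Z B\<^sub>1 \<zero>\<^bsub>Hom C Z B\<^sub>1\<^esub> A B f)"


section \<open>Triangulated categories\<close>

text \<open>\<open>shO\<close> and \<open>shM\<close> are the action of the shift functor on objects and on morphisms;
  \<open>tri C X Y Z f g h\<close> says that \<open>f : X \<rightarrow> Y\<close>, \<open>g : Y \<rightarrow> Z\<close>, \<open>h : Z \<rightarrow> X[1]\<close>
  form a distinguished triangle.\<close>

record ('k, 'o, 'm) tri_cat = "('k, 'o, 'm) lin_cat" +
  shO :: "'o \<Rightarrow> 'o"
  shM :: "'m \<Rightarrow> 'm"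
  tri :: "'o \<Rightarrow> 'o \<Rightarrow> 'o \<Rightarrow> 'm \<Rightarrow> 'm \<Rightarrow> 'm \<Rightarrow> bool"

text \<open>As usual, the shift functor is an automorphism of the category, so that \<open>X[-1]\<close> is
  literally the preimage of \<open>X\<close>. The axioms \<open>TR1\<close> to \<open>TR4\<close> are those of Verdier.\<close>

locale triangulated_linear_category =
  additive_linear_category K C
  for K :: "('k, 'r) ring_scheme" and C :: "('k, 'o, 'm, 'z) tri_cat_scheme" (structure) +
  assumes shift_Obj: "bij_betw (shO C) (Obj C) (Obj C)"
    and shift_Mor:
      "\<lbrakk>X \<in> Obj C; Y \<in> Obj C\<rbrakk>
       \<Longrightarrow> shM C \<in> linear_isos K (Hom C X Y) (Hom C (shO C X) (shO C Y))"
    and shift_idn: "X \<in> Obj C \<Longrightarrow> shM C (idn C X) = idn C (shO C X)"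
    and shift_cmp:
      "\<lbrakk>X \<in> Obj C; Y \<in> Obj C; Z \<in> Obj C; f \<in> Mor C X Y; g \<in> Mor C Y Z\<rbrakk>
       \<Longrightarrow> shM C (g \<cdot> f) = shM C g \<cdot> shM C f"
    and tri_closed:
      "tri C X Y Z f g h \<Longrightarrow>
         X \<in> Obj C \<and> Y \<in> Obj C \<and> Z \<in> Obj C \<and>
         f \<in> Mor C X Y \<and> g \<in> Mor C Y Z \<and> h \<in> Mor C Z (shO C X)"
    and TR1_iso:
      "\<lbrakk>tri C X Y Z f g h; X' \<in> Obj C; Y' \<in> Obj C; Z' \<in> Obj C;
        f' \<in> Mor C X' Y'; g' \<in> Mor C Y' Z'; h' \<in> Mor C Z' (shO C X');
        isomorphism C X X' a; isomorphism C Y Y' b; isomorphism C Z Z' c;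
        b \<cdot> f = f' \<cdot> a; c \<cdot> g = g' \<cdot> b; shM C a \<cdot> h = h' \<cdot> c\<rbrakk>
       \<Longrightarrow> tri C X' Y' Z' f' g' h'"
    and TR1_idn:
      "\<lbrakk>X \<in> Obj C; zero_object C Z\<rbrakk>
       \<Longrightarrow> tri C X X Z (idn C X) \<zero>\<^bsub>Hom C X Z\<^esub> \<zero>\<^bsub>Hom C Z (shO C X)\<^esub>"
    and TR1_cone:
      "\<lbrakk>X \<in> Obj C; Y \<in> Obj C; f \<in> Mor C X Y\<rbrakk> \<Longrightarrow> \<exists>Z g h. tri C X Y Z f g h"
    and TR2:
      "\<lbrakk>X \<in> Obj C; Y \<in> Obj C; Z \<in> Obj C;
        f \<in> Mor C X Y; g \<in> Mor C Y Z; h \<in> Mor C Z (shO C X)\<rbrakk>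
       \<Longrightarrow> tri C X Y Z f g h \<longleftrightarrow>
           tri C Y Z (shO C X) g h (\<ominus>\<^bsub>Hom C (shO C X) (shO C Y)\<^esub> shM C f)"
    and TR3:
      "\<lbrakk>tri C X Y Z f g h; tri C X' Y' Z' f' g' h';
        a \<in> Mor C X X'; b \<in> Mor C Y Y'; b \<cdot> f = f' \<cdot> a\<rbrakk>
       \<Longrightarrow> \<exists>c\<in>Mor C Z Z'. c \<cdot> g = g' \<cdot> b \<and> shM C a \<cdot> h = h' \<cdot> c"
    and TR4:
      "\<lbrakk>tri C X Y Z' f f\<^sub>1 f\<^sub>2; tri C Y Z X' g g\<^sub>1 g\<^sub>2; tri C X Z Y' (g \<cdot> f) h\<^sub>1 h\<^sub>2\<rbrakk>
       \<Longrightarrow> \<exists>u\<in>Mor C Z' Y'. \<exists>v\<in>Mor C Y' X'.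
             tri C Z' Y' X' u v (shM C f\<^sub>1 \<cdot> g\<^sub>2) \<and>
             u \<cdot> f\<^sub>1 = h\<^sub>1 \<cdot> g \<and> h\<^sub>2 \<cdot> u = f\<^sub>2 \<and>
             v \<cdot> h\<^sub>1 = g\<^sub>1 \<and> g\<^sub>2 \<cdot> v = shM C f \<cdot> h\<^sub>2"

text \<open>The last condition is naturality in both arguments, for \<open>a : X' \<rightarrow> X\<close> and
  \<open>b : Y \<rightarrow> Y'\<close>, evaluated at \<open>u : Y' \<rightarrow> X'[2]\<close>.\<close>

definition Calabi_Yau_2 ::
  "('k, 'r) ring_scheme \<Rightarrow> ('k, 'o, 'm, 'z) tri_cat_scheme \<Rightarrow> bool"
  where "Calabi_Yau_2 K C \<longleftrightarrow>
    (\<exists>\<Phi>.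
      (\<forall>X\<in>Obj C. \<forall>Y\<in>Obj C.
         \<Phi> X Y \<in> linear_isos K (Hom C X Y) (dual_module K (Hom C Y (shO C (shO C X))))) \<and>
      (\<forall>X\<in>Obj C. \<forall>Y\<in>Obj C. \<forall>X'\<in>Obj C. \<forall>Y'\<in>Obj C.
         \<forall>f\<in>Mor C X Y. \<forall>a\<in>Mor C X' X. \<forall>b\<in>Mor C Y Y'. \<forall>u\<in>Mor C Y' (shO C (shO C X')).
           \<Phi> X' Y' (b \<cdot>\<^bsub>C\<^esub> f \<cdot>\<^bsub>C\<^esub> a) u =
           \<Phi> X Y f (shM C (shM C a) \<cdot>\<^bsub>C\<^esub> u \<cdot>\<^bsub>C\<^esub> b)))"

definition rigid :: "('k, 'o, 'm, 'z) tri_cat_scheme \<Rightarrow> 'o \<Rightarrow> bool"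
  where "rigid C U \<longleftrightarrow> U \<in> Obj C \<and> Mor C U (shO C U) = {\<zero>\<^bsub>Hom C U (shO C U)\<^esub>}"

definition cluster_tilting :: "('k, 'o, 'm, 'z) tri_cat_scheme \<Rightarrow> 'o \<Rightarrow> bool"
  where "cluster_tilting C T \<longleftrightarrow> T \<in> Obj C \<and>
    add_closure C T = {X \<in> Obj C. Mor C T (shO C X) = {\<zero>\<^bsub>Hom C T (shO C X)\<^esub>}}"

definition unshift :: "('k, 'o, 'm, 'z) tri_cat_scheme \<Rightarrow> 'o \<Rightarrow> 'o"
  where "unshift C X = the_inv_into (Obj C) (shO C) X"

text \<open>\<open>X\<close> is the third term \<open>X\<^sub>U\<close> of a triangle
  \<open>W[-1] \<rightarrow> U' \<rightarrow> X\<^sub>U \<rightarrow> W\<close> as in the construction of the completion; note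
  \<open>W[-1][1] = W\<close>.\<close>

definition co_Bongartz_complement ::
  "('k, 'o, 'm, 'z) tri_cat_scheme \<Rightarrow> 'o \<Rightarrow> 'o \<Rightarrow> 'o \<Rightarrow> bool"
  where "co_Bongartz_complement C U W X \<longleftrightarrow>
    (\<exists>U' f g h. tri C (unshift C W) U' X f g h \<and>
       left_approximation C U (unshift C W) U' f \<and> left_minimal C (unshift C W) U' f)"

text \<open>The completion is only determined up to isomorphism: the following says that \<open>V\<close>
  is one of its representatives.\<close>

definition co_Bongartz_completion ::
  "('k, 'o, 'm, 'z) tri_cat_scheme \<Rightarrow> 'o \<Rightarrow> 'o \<Rightarrow> 'o \<Rightarrow> bool"
  where "co_Bongartz_completion C U W V \<longleftrightarrow>
    (\<exists>X S. co_Bongartz_complement C U W X \<and> direct_sum C [U, X] S \<and> basic_version C S V)"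

end

theory Submission
  imports Defs "HOL-Algebra.AbelCoset"
begin

text \<open>
  Write \<open>A = T[-1]\<close>, let \<open>A \<rightarrow> U' \<rightarrow> X \<rightarrow> T\<close> be the triangle over a left approximation
  \<open>f\<close> of \<open>A\<close> by \<open>add U\<close>, and let \<open>S\<close> be the direct sum of \<open>U\<close> and \<open>X\<close>. Being cluster
  tilting depends only on the additive closure, so the point is that \<open>S\<close> is cluster tilting.
  The Calabi-Yau duality enters only as a symmetry: \<open>Hom(V, W[1]) = 0\<close> implies
  \<open>Hom(W, V[1]) = 0\<close> (\<open>Ext_symmetric\<close>).

  \<open>S\<close> is rigid (\<open>complement_Ext_vanishes\<close>). A map \<open>X \<rightarrow> U[1]\<close> vanishes on \<open>U'\<close> because \<open>U\<close>
  is rigid, so it factors through \<open>T = A[1]\<close>; the factor is the shift of a map \<open>A \<rightarrow> U\<close>, hence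
  it passes through \<open>f[1]\<close>, and \<open>f[1]\<close> kills the map \<open>X \<rightarrow> T\<close>. By symmetry
  \<open>Hom(U, X[1]) = 0\<close>. A map \<open>X \<rightarrow> X[1]\<close> then factors through \<open>T\<close> as well, and
  \<open>Hom(T, T[1]) = 0\<close> lets the factor \<open>T \<rightarrow> X[1]\<close> be pulled back to \<open>U'[1]\<close>; again it
  passes through \<open>f[1]\<close>.

  \<open>S\<close> is maximal (\<open>completion_maximal\<close>). Suppose \<open>Hom(S, Y[1]) = 0\<close>. Take left approximations
  \<open>s : Y \<rightarrow> S\<^sup>n\<close> and \<open>t : Y \<rightarrow> T\<^sup>m\<close> with cones \<open>Q\<^sub>1\<close> and \<open>Q\<^sub>0\<close>. Since \<open>Y\<close> and \<open>Q\<^sub>1\<close> have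
  no nonzero maps to \<open>U'[1]\<close>, every map from them to \<open>T\<close> lifts to \<open>X\<close>. For \<open>Y\<close> this shows that
  \<open>t\<close> factors through \<open>s\<close>, so the connecting map \<open>Q\<^sub>1 \<rightarrow> Y[1]\<close> factors through
  \<open>Q\<^sub>0 \<rightarrow> Y[1]\<close>. The cone \<open>Q\<^sub>0\<close> lies in \<open>add T\<close>, so the connecting map is a sum of maps
  \<open>Q\<^sub>1 \<rightarrow> T \<rightarrow> Y[1]\<close>; each of these passes through \<open>X\<close> and is zero because
  \<open>Hom(X, Y[1]) = 0\<close>. Therefore \<open>s\<close> is a split monomorphism and \<open>Y\<close> lies in \<open>add S\<close>.

  For existence, a left approximation \<open>A \<rightarrow> B\<close> with \<open>Hom(U, B)\<close> of least dimension is minimal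
  (\<open>left_minimal_approximation_exists\<close>), and a basic version arises from a Krull-Schmidt
  decomposition by keeping one summand from each isomorphism class (\<open>basic_version_exists\<close>).

  Membership in \<open>add X\<close> is handled throughout by a criterion on morphisms: \<open>Y\<close> lies in \<open>add X\<close>
  iff the identity of \<open>Y\<close> is a finite sum of composites \<open>Y \<rightarrow> X \<rightarrow> Y\<close> (\<open>add_closure_iff\<close>).
\<close>

section \<open>Generating sets of vector spaces\<close>

text \<open>Being inductive, this description of the span makes closure properties and the behaviour
  under linear maps provable by rule induction, with no bookkeeping of coefficients.\<close>
inductive_set lin_span ::
  "('k, 'r) ring_scheme \<Rightarrow> ('k, 'a, 'p) module_scheme \<Rightarrow> 'a set \<Rightarrow> 'a set"
  for K V G where
    zero: "\<zero>\<^bsub>V\<^esub> \<in> lin_span K V G"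
  | step: "\<lbrakk>a \<in> carrier K; b \<in> G; v \<in> lin_span K V G\<rbrakk> \<Longrightarrow> a \<odot>\<^bsub>V\<^esub> b \<oplus>\<^bsub>V\<^esub> v \<in> lin_span K V G"

lemma linear_mapsD:
  assumes "\<phi> \<in> linear_maps K V W"
  shows "x \<in> carrier V \<Longrightarrow> \<phi> x \<in> carrier W"
    and "\<lbrakk>x \<in> carrier V; y \<in> carrier V\<rbrakk> \<Longrightarrow> \<phi> (x \<oplus>\<^bsub>V\<^esub> y) = \<phi> x \<oplus>\<^bsub>W\<^esub> \<phi> y"
    and "\<lbrakk>a \<in> carrier K; x \<in> carrier V\<rbrakk> \<Longrightarrow> \<phi> (a \<odot>\<^bsub>V\<^esub> x) = a \<odot>\<^bsub>W\<^esub> \<phi> x"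
  using assms by (auto simp: linear_maps_def hom_def)

lemma linear_maps_group_hom:
  assumes "\<phi> \<in> linear_maps K V W" "abelian_group V" "abelian_group W"
  shows "abelian_group_hom V W \<phi>"
  using assms by (intro abelian_group_homI group_hom.intro abelian_group.a_group
      group_hom_axioms.intro) (auto simp: linear_maps_def)

context module
begin

lemma lin_span_closed:
  assumes "G \<subseteq> carrier M" "v \<in> lin_span R M G"
  shows "v \<in> carrier M"
  using assms(2) by induction (use assms(1) in auto)

lemma lin_span_add:
  assumes "G \<subseteq> carrier M" "v \<in> lin_span R M G" "w \<in> lin_span R M G"
  shows "v \<oplus>\<^bsub>M\<^esub> w \<in> lin_span R M G"
  using assms(2)
proof induction
  case zero
  then show ?case using assms lin_span_closed by simp
next
  case (step a b v)
  then have "a \<odot>\<^bsub>M\<^esub> b \<oplus>\<^bsub>M\<^esub> v \<oplus>\<^bsub>M\<^esub> w = a \<odot>\<^bsub>M\<^esub> b \<oplus>\<^bsub>M\<^esub> (v \<oplus>\<^bsub>M\<^esub> w)"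
    using assms lin_span_closed by (intro M.a_assoc) auto
  then show ?case using step by (simp add: lin_span.step)
qed

lemma lin_span_smult:
  assumes "G \<subseteq> carrier M" "c \<in> carrier R" "v \<in> lin_span R M G"
  shows "c \<odot>\<^bsub>M\<^esub> v \<in> lin_span R M G"
  using assms(3)
proof induction
  case zero
  then show ?case using assms by (simp add: lin_span.zero)
next
  case (step a b v)
  then have "c \<odot>\<^bsub>M\<^esub> (a \<odot>\<^bsub>M\<^esub> b \<oplus>\<^bsub>M\<^esub> v) = (c \<otimes> a) \<odot>\<^bsub>M\<^esub> b \<oplus>\<^bsub>M\<^esub> c \<odot>\<^bsub>M\<^esub> v"
    using assms lin_span_closed by (subst smult_r_distr) (auto simp: smult_assoc1 subset_iff)
  then show ?case using step assms by (simp add: lin_span.step)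
qed

lemma lin_span_base:
  assumes "G \<subseteq> carrier M" "b \<in> G"
  shows "b \<in> lin_span R M G"
  using lin_span.step[OF R.one_closed assms(2) lin_span.zero, of M] assms by auto

lemma lin_span_least:
  assumes "H \<subseteq> carrier M" "G \<subseteq> lin_span R M H"
  shows "lin_span R M G \<subseteq> lin_span R M H"
proof
  fix v assume "v \<in> lin_span R M G"
  then show "v \<in> lin_span R M H"
    by induction (use assms in \<open>auto intro!: lin_span_add lin_span_smult lin_span.zero\<close>)
qed

lemma finite_dimensional_lin_span:
  assumes "finite_dimensional R M"
  obtains G where "finite G" "G \<subseteq> carrier M" "lin_span R M G = carrier M"
proof -
  obtain B where B: "finite B" "B \<subseteq> carrier M"
      "\<And>v. v \<in> carrier M \<Longrightarrow> \<exists>c\<in>B \<rightarrow> carrier R. v = (\<Oplus>\<^bsub>M\<^esub>b\<in>B. c b \<odot>\<^bsub>M\<^esub> b)"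
    using assms unfolding finite_dimensional_def by metis
  have sum: "(\<Oplus>\<^bsub>M\<^esub>b\<in>F. c b \<odot>\<^bsub>M\<^esub> b) \<in> lin_span R M B"
    if "c \<in> B \<rightarrow> carrier R" "F \<subseteq> B" for c F
    using finite_subset[OF that(2) B(1)] that(2)
  proof (induction F)
    case empty
    then show ?case by (simp add: lin_span.zero)
  next
    case (insert b F)
    then have "(\<Oplus>\<^bsub>M\<^esub>b\<in>insert b F. c b \<odot>\<^bsub>M\<^esub> b) = c b \<odot>\<^bsub>M\<^esub> b \<oplus>\<^bsub>M\<^esub> (\<Oplus>\<^bsub>M\<^esub>b\<in>F. c b \<odot>\<^bsub>M\<^esub> b)"
      using that(1) B(2) by (intro M.finsum_insert) (auto simp: Pi_iff subset_iff)
    then show ?case using insert that(1) by (auto intro!: lin_span.step)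
  qed
  have "lin_span R M B = carrier M"
    using B(2,3) sum lin_span_closed by blast
  then show thesis using B that by blast
qed

lemma lin_span_image:
  assumes "\<phi> \<in> linear_maps R M N" "module R N" "G \<subseteq> carrier M" "v \<in> lin_span R M G"
  shows "\<phi> v \<in> lin_span R N (\<phi> ` G)"
  using assms(4)
proof induction
  case zero
  interpret N: module R N by fact
  interpret abelian_group_hom M N \<phi>
    by (intro linear_maps_group_hom[OF assms(1)]) unfold_locales
  show ?case by (simp add: lin_span.zero)
next
  case (step a b v)
  have "b \<in> carrier M" "v \<in> carrier M" using step assms(3) lin_span_closed by auto
  then have "\<phi> (a \<odot>\<^bsub>M\<^esub> b \<oplus>\<^bsub>M\<^esub> v) = a \<odot>\<^bsub>N\<^esub> \<phi> b \<oplus>\<^bsub>N\<^esub> \<phi> v"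
    using step linear_mapsD[OF assms(1)] by simp
  then show ?case using step by (auto intro: lin_span.step)
qed

lemma lin_span_insert:
  assumes "insert b G \<subseteq> carrier M" "v \<in> lin_span R M (insert b G)"
  obtains a w where "a \<in> carrier R" "w \<in> lin_span R M G" "v = a \<odot>\<^bsub>M\<^esub> b \<oplus>\<^bsub>M\<^esub> w"
proof -
  have "\<exists>a w. a \<in> carrier R \<and> w \<in> lin_span R M G \<and> v = a \<odot>\<^bsub>M\<^esub> b \<oplus>\<^bsub>M\<^esub> w"
    using assms(2)
  proof induction
    case zero
    have "\<zero>\<^bsub>M\<^esub> = \<zero> \<odot>\<^bsub>M\<^esub> b \<oplus>\<^bsub>M\<^esub> \<zero>\<^bsub>M\<^esub>" using assms by simp
    then show ?case using lin_span.zero by blast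
  next
    case (step c d v)
    then obtain a w where aw: "a \<in> carrier R" "w \<in> lin_span R M G" "v = a \<odot>\<^bsub>M\<^esub> b \<oplus>\<^bsub>M\<^esub> w"
      by blast
    have w: "w \<in> carrier M" using aw assms lin_span_closed by blast
    show ?case
    proof (cases "d = b")
      case True
      then have "c \<odot>\<^bsub>M\<^esub> d \<oplus>\<^bsub>M\<^esub> v = (c \<oplus> a) \<odot>\<^bsub>M\<^esub> b \<oplus>\<^bsub>M\<^esub> w"
        using aw w step assms by (simp add: smult_l_distr M.a_assoc)
      then show ?thesis using aw step by blast
    next
      case False
      then have "c \<odot>\<^bsub>M\<^esub> d \<oplus>\<^bsub>M\<^esub> w \<in> lin_span R M G" using step aw by (auto intro: lin_span.step)
      moreover have "c \<odot>\<^bsub>M\<^esub> d \<oplus>\<^bsub>M\<^esub> v = a \<odot>\<^bsub>M\<^esub> b \<oplus>\<^bsub>M\<^esub> (c \<odot>\<^bsub>M\<^esub> d \<oplus>\<^bsub>M\<^esub> w)"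
        using aw w step assms by (auto intro!: M.a_lcomm)
      ultimately show ?thesis using aw by blast
    qed
  qed
  then show thesis using that by blast
qed

end

text \<open>Some coefficient of \<open>v\<close> is nonzero, and the corresponding generator can be solved for.\<close>
lemma (in module) lin_span_exchange:
  assumes "field R" "finite G" "G \<subseteq> carrier M" "v \<in> lin_span R M G" "v \<noteq> \<zero>\<^bsub>M\<^esub>"
  shows "\<exists>b\<in>G. b \<in> lin_span R M (insert v (G - {b}))"
  using assms(2-5)
proof (induction G)
  case empty
  from empty(2) have "v = \<zero>\<^bsub>M\<^esub>" by cases auto
  then show ?case using empty by simp
next
  case (insert b G)
  interpret field R by fact
  obtain a w where aw: "a \<in> carrier R" "w \<in> lin_span R M G" "v = a \<odot>\<^bsub>M\<^esub> b \<oplus>\<^bsub>M\<^esub> w"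
    using lin_span_insert insert.prems by blast
  have G: "G \<subseteq> carrier M" "b \<in> carrier M" and v: "v \<in> carrier M" and w: "w \<in> carrier M"
    using insert.prems aw lin_span_closed by auto
  have vG: "insert v G \<subseteq> carrier M" using v G by simp
  show ?case
  proof (cases "a = \<zero>")
    case True
    then have "v = w" using aw w G by simp
    then obtain d where d: "d \<in> G" "d \<in> lin_span R M (insert v (G - {d}))"
      using insert.IH G aw insert.prems by blast
    have "insert v (insert b G - {d}) \<subseteq> carrier M" using vG G by auto
    then have "lin_span R M (insert v (G - {d})) \<subseteq> lin_span R M (insert v (insert b G - {d}))"
      by (intro lin_span_least) (auto intro!: lin_span_base)
    then show ?thesis using d by blast
  next
    case False
    define i where "i = inv a"
    have i: "i \<in> carrier R" "i \<otimes> a = \<one>"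
      using False aw field_Units by (auto simp: i_def)
    have "v \<oplus>\<^bsub>M\<^esub> \<ominus>\<^bsub>M\<^esub> w = a \<odot>\<^bsub>M\<^esub> b"
      using aw w G v by (simp add: M.a_assoc M.r_neg)
    moreover have "\<ominus>\<^bsub>M\<^esub> w = (\<ominus> \<one>) \<odot>\<^bsub>M\<^esub> w" using w by (simp add: smult_l_minus)
    ultimately have "i \<odot>\<^bsub>M\<^esub> (v \<oplus>\<^bsub>M\<^esub> (\<ominus> \<one>) \<odot>\<^bsub>M\<^esub> w) = b"
      using i G aw by (simp add: smult_assoc1[symmetric])
    moreover have "w \<in> lin_span R M (insert v G)"
      using lin_span_least[OF vG, of G] lin_span_base[OF vG] aw by blast
    ultimately have "b \<in> lin_span R M (insert v G)"
      using i vG by (metis R.one_closed R.a_inv_closed lin_span_add lin_span_base lin_span_smult insertI1)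
    then show ?thesis using insert.hyps by auto
  qed
qed

text \<open>This is all of dimension theory that the existence of minimal approximations
  rests on: a nonzero element of the kernel makes the image of one generator redundant.\<close>
lemma (in module) generators_of_proper_quotient:
  assumes "field R" "module R N" "\<phi> \<in> linear_maps R M N" "carrier N \<subseteq> \<phi> ` carrier M"
    and "v \<in> carrier M" "v \<noteq> \<zero>\<^bsub>M\<^esub>" "\<phi> v = \<zero>\<^bsub>N\<^esub>"
    and G: "finite G" "G \<subseteq> carrier M" "lin_span R M G = carrier M"
  obtains H where "finite H" "H \<subseteq> carrier N" "lin_span R N H = carrier N" "card H < card G"
proof -
  interpret N: module R N by fact
  obtain b where b: "b \<in> G" "b \<in> lin_span R M (insert v (G - {b}))"
    using lin_span_exchange[of G v] assms by auto
  define H where "H = \<phi> ` (G - {b})"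
  have H: "H \<subseteq> carrier N" using linear_mapsD(1)[OF assms(3)] G by (auto simp: H_def)
  have "\<phi> b \<in> lin_span R N (\<phi> ` insert v (G - {b}))"
    using b G assms by (intro lin_span_image) auto
  also have "\<dots> \<subseteq> lin_span R N H"
    using H assms(7) by (intro N.lin_span_least) (auto simp: H_def lin_span.zero intro: N.lin_span_base)
  finally have "\<phi> ` G \<subseteq> lin_span R N H" using N.lin_span_base[OF H] by (auto simp: H_def)
  then have "lin_span R N (\<phi> ` G) \<subseteq> lin_span R N H" using H by (intro N.lin_span_least)
  moreover have "carrier N \<subseteq> lin_span R N (\<phi> ` G)"
    using assms(4) lin_span_image[OF assms(3,2) G(2)] G(3) by auto
  ultimately have "lin_span R N H = carrier N" using N.lin_span_closed[OF H] by blast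
  moreover have "card H < card G"
    using b G(1) card_image_le[of "G - {b}" \<phi>] card_Diff1_less[of G b] by (auto simp: H_def)
  ultimately show thesis using that[OF _ H] G(1) by (simp add: H_def)
qed

section \<open>Computing in a linear category\<close>

context linear_category
begin

text \<open>The spaces \<open>Hom C X Y\<close> are unconstrained unless \<open>X\<close> and \<open>Y\<close> are objects; bundling
  these side conditions keeps the rules for composition free of them.\<close>
definition arr :: "'o \<Rightarrow> 'o \<Rightarrow> 'm \<Rightarrow> bool"
  where "arr X Y f \<longleftrightarrow> X \<in> Obj C \<and> Y \<in> Obj C \<and> f \<in> Mor C X Y"

abbreviation nul :: "'o \<Rightarrow> 'o \<Rightarrow> 'm"
  where "nul X Y \<equiv> \<zero>\<^bsub>Hom C X Y\<^esub>"

lemma arrI: "\<lbrakk>X \<in> Obj C; Y \<in> Obj C; f \<in> Mor C X Y\<rbrakk> \<Longrightarrow> arr X Y f"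
  by (simp add: arr_def)

lemma arrD: assumes "arr X Y f" shows "X \<in> Obj C" "Y \<in> Obj C" "f \<in> Mor C X Y"
  using assms by (auto simp: arr_def)

lemma Hom_abelian_group: "\<lbrakk>X \<in> Obj C; Y \<in> Obj C\<rbrakk> \<Longrightarrow> abelian_group (Hom C X Y)"
  using Hom_module module.axioms(2) by blast

lemma arr_idn: "X \<in> Obj C \<Longrightarrow> arr X X (idn C X)"
  by (simp add: arr_def idn_closed)

lemma arr_cmp: "\<lbrakk>arr X Y f; arr Y Z g\<rbrakk> \<Longrightarrow> arr X Z (g \<cdot> f)"
  by (auto simp: arr_def cmp_closed)

lemma arr_nul: "\<lbrakk>X \<in> Obj C; Y \<in> Obj C\<rbrakk> \<Longrightarrow> arr X Y (nul X Y)"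
  using Hom_abelian_group[of X Y] by (simp add: arr_def abelian_groupE)

lemma arr_add: "\<lbrakk>arr X Y f; arr X Y g\<rbrakk> \<Longrightarrow> arr X Y (f \<oplus>\<^bsub>Hom C X Y\<^esub> g)"
  using Hom_abelian_group[of X Y] by (auto simp: arr_def abelian_groupE)

lemma arr_neg: "arr X Y f \<Longrightarrow> arr X Y (\<ominus>\<^bsub>Hom C X Y\<^esub> f)"
  using Hom_abelian_group[of X Y] by (auto simp: arr_def abelian_group.a_inv_closed)

lemma cmp_idn_left: "arr X Y f \<Longrightarrow> idn C Y \<cdot> f = f"
  by (auto simp: arr_def idn_left)

lemma cmp_idn_right: "arr X Y f \<Longrightarrow> f \<cdot> idn C X = f"
  by (auto simp: arr_def idn_right)

lemma assoc: "\<lbrakk>arr W X f; arr X Y g; arr Y Z h\<rbrakk> \<Longrightarrow> h \<cdot> g \<cdot> f = h \<cdot> (g \<cdot> f)"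
  unfolding arr_def using cmp_assoc[of W X Y Z f g h] by blast

lemma postcompose_hom:
  assumes "arr Y Z g" "X \<in> Obj C"
  shows "abelian_group_hom (Hom C X Y) (Hom C X Z) (\<lambda>f. g \<cdot> f)"
  using assms by (auto simp: arr_def intro!: linear_maps_group_hom cmp_linear_right Hom_abelian_group)

lemma precompose_hom:
  assumes "arr X Y f" "Z \<in> Obj C"
  shows "abelian_group_hom (Hom C Y Z) (Hom C X Z) (\<lambda>g. g \<cdot> f)"
  using assms by (auto simp: arr_def intro!: linear_maps_group_hom cmp_linear_left Hom_abelian_group)

lemma cmp_nul_right: "\<lbrakk>arr Y Z g; X \<in> Obj C\<rbrakk> \<Longrightarrow> g \<cdot> nul X Y = nul X Z"
  using abelian_group_hom.hom_zero[OF postcompose_hom] by blast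

lemma cmp_nul_left: "\<lbrakk>arr X Y f; Z \<in> Obj C\<rbrakk> \<Longrightarrow> nul Y Z \<cdot> f = nul X Z"
  using abelian_group_hom.hom_zero[OF precompose_hom] by blast

lemma cmp_add_right:
  "\<lbrakk>arr X Y f; arr X Y f'; arr Y Z g\<rbrakk> \<Longrightarrow>
     g \<cdot> (f \<oplus>\<^bsub>Hom C X Y\<^esub> f') = g \<cdot> f \<oplus>\<^bsub>Hom C X Z\<^esub> g \<cdot> f'"
  using abelian_group_hom.hom_add[OF postcompose_hom, of Y Z g X f f'] arrD by blast

lemma cmp_add_left:
  "\<lbrakk>arr X Y f; arr Y Z g; arr Y Z g'\<rbrakk> \<Longrightarrow>
     (g \<oplus>\<^bsub>Hom C Y Z\<^esub> g') \<cdot> f = g \<cdot> f \<oplus>\<^bsub>Hom C X Z\<^esub> g' \<cdot> f"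
  using abelian_group_hom.hom_add[OF precompose_hom, of X Y f Z g g'] arrD by blast

lemma cmp_neg_right:
  "\<lbrakk>arr X Y f; arr Y Z g\<rbrakk> \<Longrightarrow> g \<cdot> (\<ominus>\<^bsub>Hom C X Y\<^esub> f) = \<ominus>\<^bsub>Hom C X Z\<^esub> (g \<cdot> f)"
  using abelian_group_hom.hom_a_inv[OF postcompose_hom, of Y Z g X f] arrD by blast

lemma cmp_neg_left:
  "\<lbrakk>arr X Y f; arr Y Z g\<rbrakk> \<Longrightarrow> (\<ominus>\<^bsub>Hom C Y Z\<^esub> g) \<cdot> f = \<ominus>\<^bsub>Hom C X Z\<^esub> (g \<cdot> f)"
  using abelian_group_hom.hom_a_inv[OF precompose_hom, of X Y f Z g] arrD by blast

lemma add_nul: "arr X Y f \<Longrightarrow> f \<oplus>\<^bsub>Hom C X Y\<^esub> nul X Y = f"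
  and nul_add: "arr X Y f \<Longrightarrow> nul X Y \<oplus>\<^bsub>Hom C X Y\<^esub> f = f"
  and add_neg: "arr X Y f \<Longrightarrow> f \<oplus>\<^bsub>Hom C X Y\<^esub> (\<ominus>\<^bsub>Hom C X Y\<^esub> f) = nul X Y"
  and neg_add: "arr X Y f \<Longrightarrow> (\<ominus>\<^bsub>Hom C X Y\<^esub> f) \<oplus>\<^bsub>Hom C X Y\<^esub> f = nul X Y"
  and neg_neg: "arr X Y f \<Longrightarrow> \<ominus>\<^bsub>Hom C X Y\<^esub> (\<ominus>\<^bsub>Hom C X Y\<^esub> f) = f"
  using Hom_abelian_group[of X Y]
  by (auto simp: arr_def abelian_group.axioms(1) abelian_monoid.r_zero abelian_monoid.l_zero
      abelian_group.r_neg abelian_group.l_neg abelian_group.minus_minus)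

lemma neg_nul: "\<lbrakk>X \<in> Obj C; Y \<in> Obj C\<rbrakk> \<Longrightarrow> \<ominus>\<^bsub>Hom C X Y\<^esub> nul X Y = nul X Y"
  using add_neg[OF arr_nul] nul_add[OF arr_neg[OF arr_nul]] by metis

lemma add_assoc:
  "\<lbrakk>arr X Y f; arr X Y g; arr X Y h\<rbrakk> \<Longrightarrow>
     f \<oplus>\<^bsub>Hom C X Y\<^esub> g \<oplus>\<^bsub>Hom C X Y\<^esub> h = f \<oplus>\<^bsub>Hom C X Y\<^esub> (g \<oplus>\<^bsub>Hom C X Y\<^esub> h)"
  using Hom_abelian_group[of X Y] by (auto simp: arr_def abelian_group.axioms(1) abelian_monoid.a_assoc)

lemma zero_object_iff: "zero_object C X \<longleftrightarrow> X \<in> Obj C \<and> idn C X = nul X X"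
proof
  assume "zero_object C X"
  then show "X \<in> Obj C \<and> idn C X = nul X X"
    using arr_idn[of X] arr_nul[of X X] by (auto simp: zero_object_def arr_def)
next
  assume X: "X \<in> Obj C \<and> idn C X = nul X X"
  have "f = nul X Y" if "arr X Y f" for f Y
    using X cmp_idn_right[OF that] cmp_nul_right[OF that] by simp
  moreover have "f = nul Y X" if "arr Y X f" for f Y
    using X cmp_idn_left[OF that] cmp_nul_left[OF that] by simp
  ultimately show "zero_object C X"
    using X arr_nul arrD(3) unfolding zero_object_def by (metis arrI)
qed

section \<open>Morphisms that factor through sums of copies of an object\<close>

text \<open>The value of the ideal generated by the identity of \<open>X\<close> at the pair \<open>(Y, Z)\<close>: all finite
  sums of composites \<open>Y \<rightarrow> X \<rightarrow> Z\<close>.\<close>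
inductive_set through :: "'o \<Rightarrow> 'o \<Rightarrow> 'o \<Rightarrow> 'm set"
  for X Y Z where
    zero: "nul Y Z \<in> through X Y Z"
  | step: "\<lbrakk>arr Y X a; arr X Z b; h \<in> through X Y Z\<rbrakk> \<Longrightarrow> b \<cdot> a \<oplus>\<^bsub>Hom C Y Z\<^esub> h \<in> through X Y Z"

lemma through_arr:
  assumes "Y \<in> Obj C" "Z \<in> Obj C" "h \<in> through X Y Z" shows "arr Y Z h"
  using assms(3) by induction (use assms(1,2) in \<open>auto intro: arr_nul arr_add arr_cmp\<close>)

lemma through_single: "\<lbrakk>arr Y X a; arr X Z b\<rbrakk> \<Longrightarrow> b \<cdot> a \<in> through X Y Z"
  using through.step[OF _ _ through.zero] add_nul arr_cmp by metis

lemma through_idn: "X \<in> Obj C \<Longrightarrow> idn C X \<in> through X X X"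
  using through_single[OF arr_idn arr_idn] cmp_idn_left arr_idn by metis

lemma through_add:
  assumes "Y \<in> Obj C" "Z \<in> Obj C" "h \<in> through X Y Z" "k \<in> through X Y Z"
  shows "h \<oplus>\<^bsub>Hom C Y Z\<^esub> k \<in> through X Y Z"
  using assms(3)
proof induction
  case zero
  then show ?case using assms through_arr nul_add by simp
next
  case (step a b h)
  then show ?case using add_assoc through_arr assms arr_cmp through.step by metis
qed

lemma through_cmp_left:
  assumes "Y \<in> Obj C" "arr Z W g" "h \<in> through X Y Z"
  shows "g \<cdot> h \<in> through X Y W"
  using assms(3)
proof induction
  case zero
  then show ?case using assms cmp_nul_right by (simp add: through.zero)
next
  case (step a b h)
  then have "g \<cdot> (b \<cdot> a \<oplus>\<^bsub>Hom C Y Z\<^esub> h) = g \<cdot> b \<cdot> a \<oplus>\<^bsub>Hom C Y W\<^esub> g \<cdot> h"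
    using assms by (subst cmp_add_right) (auto intro: arr_cmp through_arr arrD simp: assoc)
  then show ?case using step assms by (auto intro: through.step arr_cmp)
qed

lemma through_cmp_right:
  assumes "Z \<in> Obj C" "arr W Y g" "h \<in> through X Y Z"
  shows "h \<cdot> g \<in> through X W Z"
  using assms(3)
proof induction
  case zero
  then show ?case using assms cmp_nul_left by (simp add: through.zero)
next
  case (step a b h)
  then have "(b \<cdot> a \<oplus>\<^bsub>Hom C Y Z\<^esub> h) \<cdot> g = b \<cdot> (a \<cdot> g) \<oplus>\<^bsub>Hom C W Z\<^esub> h \<cdot> g"
    using assms by (subst cmp_add_left) (auto intro: arr_cmp through_arr arrD simp: assoc)
  then show ?case using step assms by (auto intro: through.step arr_cmp)
qed

text \<open>Behind the transitivity of additive closures: the identity in the middle of a composite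
  \<open>Y \<rightarrow> X \<rightarrow> X \<rightarrow> Z\<close> may be replaced by a sum of composites through \<open>W\<close>.\<close>
lemma through_trans:
  assumes "idn C X \<in> through W X X" "Y \<in> Obj C" "Z \<in> Obj C" "h \<in> through X Y Z"
  shows "h \<in> through W Y Z"
  using assms(4)
proof induction
  case (step a b h)
  then have "b \<cdot> idn C X \<cdot> a \<in> through W Y Z"
    using assms through_cmp_left[OF _ step(2) assms(1)] through_cmp_right[OF assms(3) step(1)] arrD
    by blast
  then show ?case using step assms by (auto intro: through_add simp: cmp_idn_right)
qed (rule through.zero)

lemma through_nul:
  assumes "Y \<in> Obj C" "Z \<in> Obj C" "h \<in> through X Y Z"
    and "\<And>a b. \<lbrakk>arr Y X a; arr X Z b\<rbrakk> \<Longrightarrow> b \<cdot> a = nul Y Z"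
  shows "h = nul Y Z"
  using assms(3) by induction (use assms arr_nul in \<open>auto simp: add_nul\<close>)

lemma through_finsum:
  assumes "Y \<in> Obj C" "Z \<in> Obj C" "finite I" "\<And>i. i \<in> I \<Longrightarrow> h i \<in> through X Y Z"
  shows "(\<Oplus>\<^bsub>Hom C Y Z\<^esub>i\<in>I. h i) \<in> through X Y Z"
proof -
  interpret abelian_group "Hom C Y Z" using assms Hom_abelian_group by blast
  show ?thesis
    using assms(3,4)
  proof (induction I)
    case empty
    then show ?case by (simp add: through.zero)
  next
    case (insert i I)
    then have "(\<Oplus>\<^bsub>Hom C Y Z\<^esub>i\<in>insert i I. h i) = h i \<oplus>\<^bsub>Hom C Y Z\<^esub> (\<Oplus>\<^bsub>Hom C Y Z\<^esub>i\<in>I. h i)"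
      using through_arr[OF assms(1,2)] by (intro finsum_insert) (auto simp: arr_def)
    then show ?case using insert through_add[OF assms(1,2)] by simp
  qed
qed

text \<open>The explicit sum is needed only where an actual power of \<open>X\<close> is built from a member of
  the ideal.\<close>
lemma throughE:
  assumes "h \<in> through X Y Z" "X \<in> Obj C" "Y \<in> Obj C" "Z \<in> Obj C"
  obtains n and a b :: "nat \<Rightarrow> 'm" where "\<And>i. arr Y X (a i)" "\<And>i. arr X Z (b i)"
    "h = (\<Oplus>\<^bsub>Hom C Y Z\<^esub>i\<in>{..<n}. b i \<cdot> a i)"
proof -
  interpret abelian_group "Hom C Y Z" using assms Hom_abelian_group by blast
  have "\<exists>(n::nat) a b. (\<forall>i. arr Y X (a i)) \<and> (\<forall>i. arr X Z (b i)) \<and>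
      h = (\<Oplus>\<^bsub>Hom C Y Z\<^esub>i\<in>{..<n}. b i \<cdot> a i)"
    using assms(1)
  proof induction
    case zero
    show ?case
      by (intro exI[of _ "0::nat"] exI[of _ "\<lambda>_. nul Y X"] exI[of _ "\<lambda>_. nul X Z"])
        (simp add: arr_nul assms)
  next
    case (step a b h)
    then obtain n :: nat and a' b' where h: "\<And>i. arr Y X (a' i)" "\<And>i. arr X Z (b' i)"
        "h = (\<Oplus>\<^bsub>Hom C Y Z\<^esub>i\<in>{..<n}. b' i \<cdot> a' i)" by blast
    define a'' b'' where "a'' = a'(n := a)" and "b'' = b'(n := b)"
    have ar: "arr Y X (a'' i)" "arr X Z (b'' i)" for i
      using h step by (auto simp: a''_def b''_def)
    have "(\<Oplus>\<^bsub>Hom C Y Z\<^esub>i\<in>{..<n}. b'' i \<cdot> a'' i) = (\<Oplus>\<^bsub>Hom C Y Z\<^esub>i\<in>{..<n}. b' i \<cdot> a' i)"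
      using arrD(3)[OF arr_cmp[OF h(1,2)]] by (intro finsum_cong') (auto simp: a''_def b''_def)
    moreover have "(\<Oplus>\<^bsub>Hom C Y Z\<^esub>i\<in>insert n {..<n}. b'' i \<cdot> a'' i) =
        b'' n \<cdot> a'' n \<oplus>\<^bsub>Hom C Y Z\<^esub> (\<Oplus>\<^bsub>Hom C Y Z\<^esub>i\<in>{..<n}. b'' i \<cdot> a'' i)"
      using ar arr_cmp arrD(3) by (intro finsum_insert) blast+
    ultimately have "b \<cdot> a \<oplus>\<^bsub>Hom C Y Z\<^esub> h = (\<Oplus>\<^bsub>Hom C Y Z\<^esub>i\<in>{..<Suc n}. b'' i \<cdot> a'' i)"
      using h by (simp add: lessThan_Suc a''_def b''_def)
    then show ?case using ar by blast
  qed
  then show thesis using that by blast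
qed

section \<open>Biproducts\<close>

lemma cmp_finsum_right:
  assumes "arr Y Z g" "X \<in> Obj C" "finite I" "\<And>i. i \<in> I \<Longrightarrow> arr X Y (h i)"
  shows "g \<cdot> (\<Oplus>\<^bsub>Hom C X Y\<^esub>i\<in>I. h i) = (\<Oplus>\<^bsub>Hom C X Z\<^esub>i\<in>I. g \<cdot> h i)"
proof -
  interpret abelian_group_hom "Hom C X Y" "Hom C X Z" "\<lambda>f. g \<cdot> f"
    using assms(1,2) by (rule postcompose_hom)
  show ?thesis
    using assms(3,4) by (induction I) (auto simp: arr_def Pi_iff)
qed

lemma cmp_finsum_left:
  assumes "arr X Y f" "Z \<in> Obj C" "finite I" "\<And>i. i \<in> I \<Longrightarrow> arr Y Z (h i)"
  shows "(\<Oplus>\<^bsub>Hom C Y Z\<^esub>i\<in>I. h i) \<cdot> f = (\<Oplus>\<^bsub>Hom C X Z\<^esub>i\<in>I. h i \<cdot> f)"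
proof -
  interpret abelian_group_hom "Hom C Y Z" "Hom C X Z" "\<lambda>g. g \<cdot> f"
    using assms(1,2) by (rule precompose_hom)
  show ?thesis
    using assms(3,4) by (induction I) (auto simp: arr_def Pi_iff)
qed

lemma finsum_arr:
  assumes "X \<in> Obj C" "Y \<in> Obj C" "\<And>i. i \<in> I \<Longrightarrow> arr X Y (h i)"
  shows "arr X Y (\<Oplus>\<^bsub>Hom C X Y\<^esub>i\<in>I. h i)"
proof -
  interpret abelian_group "Hom C X Y" using assms Hom_abelian_group by blast
  show ?thesis using assms by (auto simp: arr_def intro!: finsum_closed)
qed

lemma finsum_cong_arr:
  assumes "X \<in> Obj C" "Y \<in> Obj C" "\<And>i. i \<in> I \<Longrightarrow> arr X Y (k i)" "\<And>i. i \<in> I \<Longrightarrow> h i = k i"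
  shows "(\<Oplus>\<^bsub>Hom C X Y\<^esub>i\<in>I. h i) = (\<Oplus>\<^bsub>Hom C X Y\<^esub>i\<in>I. k i)"
proof -
  interpret abelian_group "Hom C X Y" using assms Hom_abelian_group by blast
  show ?thesis using assms by (intro finsum_cong') (auto simp: arr_def)
qed

lemma finsum_delta:
  assumes "X \<in> Obj C" "Y \<in> Obj C" "finite I" "j \<in> I" "arr X Y k"
    "h j = k" "\<And>i. \<lbrakk>i \<in> I; i \<noteq> j\<rbrakk> \<Longrightarrow> h i = nul X Y"
  shows "(\<Oplus>\<^bsub>Hom C X Y\<^esub>i\<in>I. h i) = k"
proof -
  interpret abelian_group "Hom C X Y" using assms Hom_abelian_group by blast
  have "(\<Oplus>\<^bsub>Hom C X Y\<^esub>i\<in>I. h i) = (\<Oplus>\<^bsub>Hom C X Y\<^esub>i\<in>I. if j = i then k else nul X Y)"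
    using assms by (intro finsum_cong') (auto simp: arr_def)
  also have "\<dots> = k" using assms by (subst finsum_singleton) (auto simp: arr_def)
  finally show ?thesis .
qed

lemma biproductD:
  assumes "biproduct C Xs S \<iota> \<pi>"
  shows "S \<in> Obj C" "i < length Xs \<Longrightarrow> Xs ! i \<in> Obj C"
    "i < length Xs \<Longrightarrow> arr (Xs ! i) S (\<iota> i)" "i < length Xs \<Longrightarrow> arr S (Xs ! i) (\<pi> i)"
    "i < length Xs \<Longrightarrow> \<pi> i \<cdot> \<iota> i = idn C (Xs ! i)"
    "\<lbrakk>i < length Xs; j < length Xs; i \<noteq> j\<rbrakk> \<Longrightarrow> \<pi> j \<cdot> \<iota> i = nul (Xs ! i) (Xs ! j)"
    "(\<Oplus>\<^bsub>Hom C S S\<^esub>i\<in>{..<length Xs}. \<iota> i \<cdot> \<pi> i) = idn C S"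
proof -
  note * = assms[unfolded biproduct_def]
  show S: "S \<in> Obj C" and "(\<Oplus>\<^bsub>Hom C S S\<^esub>i\<in>{..<length Xs}. \<iota> i \<cdot> \<pi> i) = idn C S"
    using * by blast+
  show X: "Xs ! i \<in> Obj C" if "i < length Xs" for i using * nth_mem[OF that] by blast
  show "arr (Xs ! i) S (\<iota> i)" "arr S (Xs ! i) (\<pi> i)" if "i < length Xs"
    using * X[OF that] S that by (simp_all add: arr_def)
  show "\<pi> i \<cdot> \<iota> i = idn C (Xs ! i)" if "i < length Xs"
    using * that by simp
  show "\<pi> j \<cdot> \<iota> i = nul (Xs ! i) (Xs ! j)" if "i < length Xs" "j < length Xs" "i \<noteq> j"
    using * that by simp
qed

lemma biproduct_induced:
  assumes "biproduct C Xs S \<iota> \<pi>" "Y \<in> Obj C" "\<And>i. i < length Xs \<Longrightarrow> arr Y (Xs ! i) (a i)"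
  obtains u where "arr Y S u" "\<And>i. i < length Xs \<Longrightarrow> \<pi> i \<cdot> u = a i"
proof -
  note bi = biproductD[OF assms(1)]
  define u where "u = (\<Oplus>\<^bsub>Hom C Y S\<^esub>j\<in>{..<length Xs}. \<iota> j \<cdot> a j)"
  have ar: "arr Y S (\<iota> j \<cdot> a j)" if "j < length Xs" for j
    using arr_cmp[OF assms(3)[OF that] bi(3)[OF that]] .
  have "\<pi> i \<cdot> u = a i" if i: "i < length Xs" for i
  proof -
    have "\<pi> i \<cdot> u = (\<Oplus>\<^bsub>Hom C Y (Xs ! i)\<^esub>j\<in>{..<length Xs}. \<pi> i \<cdot> (\<iota> j \<cdot> a j))"
      unfolding u_def using ar bi(4)[OF i] assms(2) by (intro cmp_finsum_right) auto
    also have "\<dots> = a i"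
    proof (rule finsum_delta[where j = i])
      show "\<pi> i \<cdot> (\<iota> i \<cdot> a i) = a i"
        using assoc[OF assms(3)[OF i] bi(3,4)[OF i]] bi(5)[OF i] cmp_idn_left assms(3)[OF i] by simp
      show "\<pi> i \<cdot> (\<iota> j \<cdot> a j) = nul Y (Xs ! i)" if "j \<in> {..<length Xs}" "j \<noteq> i" for j
        using assoc[OF assms(3) bi(3) bi(4)[OF i], of j] bi(6)[of j i]
          cmp_nul_left[OF assms(3)[of j] bi(2)[OF i]] i that by auto
    qed (use assms(2,3) i bi(2) in auto)
    finally show ?thesis .
  qed
  moreover have "arr Y S u" unfolding u_def using ar assms(2) bi(1) by (intro finsum_arr) auto
  ultimately show thesis using that by blast
qed

lemma biproduct_coinduced:
  assumes "biproduct C Xs S \<iota> \<pi>" "Z \<in> Obj C" "\<And>i. i < length Xs \<Longrightarrow> arr (Xs ! i) Z (b i)"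
  obtains v where "arr S Z v" "\<And>i. i < length Xs \<Longrightarrow> v \<cdot> \<iota> i = b i"
proof -
  note bi = biproductD[OF assms(1)]
  define v where "v = (\<Oplus>\<^bsub>Hom C S Z\<^esub>j\<in>{..<length Xs}. b j \<cdot> \<pi> j)"
  have ar: "arr S Z (b j \<cdot> \<pi> j)" if "j < length Xs" for j
    using arr_cmp[OF bi(4)[OF that] assms(3)[OF that]] .
  have "v \<cdot> \<iota> i = b i" if i: "i < length Xs" for i
  proof -
    have "v \<cdot> \<iota> i = (\<Oplus>\<^bsub>Hom C (Xs ! i) Z\<^esub>j\<in>{..<length Xs}. b j \<cdot> \<pi> j \<cdot> \<iota> i)"
      unfolding v_def using ar bi(3)[OF i] assms(2) by (intro cmp_finsum_left) auto
    also have "\<dots> = b i"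
    proof (rule finsum_delta[where j = i])
      show "b i \<cdot> \<pi> i \<cdot> \<iota> i = b i"
        using assoc[OF bi(3,4)[OF i] assms(3)[OF i]] bi(5)[OF i] cmp_idn_right assms(3)[OF i] by simp
      show "b j \<cdot> \<pi> j \<cdot> \<iota> i = nul (Xs ! i) Z" if "j \<in> {..<length Xs}" "j \<noteq> i" for j
        using assoc[OF bi(3)[OF i] bi(4) assms(3), of j] bi(6)[of i j]
          cmp_nul_right[OF assms(3)[of j] bi(2)[OF i]] i that by auto
    qed (use assms(2,3) i bi(2) in auto)
    finally show ?thesis .
  qed
  moreover have "arr S Z v" unfolding v_def using ar assms(2) bi(1) by (intro finsum_arr) auto
  ultimately show thesis using that by blast
qed

text \<open>Matrix multiplication of a row with a column.\<close>
lemma biproduct_cmp: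
  assumes "biproduct C Xs S \<iota> \<pi>" "arr Y S u" "arr S Z v"
  shows "v \<cdot> u = (\<Oplus>\<^bsub>Hom C Y Z\<^esub>i\<in>{..<length Xs}. v \<cdot> \<iota> i \<cdot> (\<pi> i \<cdot> u))"
proof -
  note bi = biproductD[OF assms(1)]
  have ar: "arr S S (\<iota> i \<cdot> \<pi> i)" if "i < length Xs" for i
    using arr_cmp[OF bi(4,3)[OF that]] .
  have "v \<cdot> u = v \<cdot> ((\<Oplus>\<^bsub>Hom C S S\<^esub>i\<in>{..<length Xs}. \<iota> i \<cdot> \<pi> i) \<cdot> u)"
    using bi(7) cmp_idn_left[OF assms(2)] by simp
  also have "\<dots> = v \<cdot> (\<Oplus>\<^bsub>Hom C Y S\<^esub>i\<in>{..<length Xs}. \<iota> i \<cdot> \<pi> i \<cdot> u)"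
    using ar assms(2) bi(1) by (subst cmp_finsum_left) auto
  also have "\<dots> = (\<Oplus>\<^bsub>Hom C Y Z\<^esub>i\<in>{..<length Xs}. v \<cdot> (\<iota> i \<cdot> \<pi> i \<cdot> u))"
    using ar assms arrD by (intro cmp_finsum_right) (auto intro: arr_cmp)
  also have "\<dots> = (\<Oplus>\<^bsub>Hom C Y Z\<^esub>i\<in>{..<length Xs}. v \<cdot> \<iota> i \<cdot> (\<pi> i \<cdot> u))"
  proof (rule finsum_cong_arr)
    fix i assume "i \<in> {..<length Xs}"
    then have i: "arr (Xs ! i) S (\<iota> i)" "arr S (Xs ! i) (\<pi> i)" using bi by auto
    show "arr Y Z (v \<cdot> \<iota> i \<cdot> (\<pi> i \<cdot> u))" using arr_cmp[OF arr_cmp[OF assms(2) i(2)] arr_cmp[OF i(1) assms(3)]] .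
    show "v \<cdot> (\<iota> i \<cdot> \<pi> i \<cdot> u) = v \<cdot> \<iota> i \<cdot> (\<pi> i \<cdot> u)"
      using assoc[OF arr_cmp[OF assms(2) i(2)] i(1) assms(3)] assoc[OF assms(2) i(2,1)] by simp
  qed (use assms arrD in auto)
  finally show ?thesis .
qed

lemma biproduct_idn_through:
  assumes "biproduct C Xs S \<iota> \<pi>"
    and "\<And>i. i < length Xs \<Longrightarrow> idn C (Xs ! i) \<in> through X (Xs ! i) (Xs ! i)"
  shows "idn C S \<in> through X S S"
proof -
  note bi = biproductD[OF assms(1)]
  have "\<iota> i \<cdot> \<pi> i \<in> through X S S" if i: "i < length Xs" for i
    using through_cmp_right[OF bi(1) bi(4)[OF i] through_cmp_left[OF bi(2)[OF i] bi(3)[OF i] assms(2)[OF i]]]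
      cmp_idn_right bi(3)[OF i] by simp
  then show ?thesis
    using bi(7) through_finsum[OF bi(1,1), of "{..<length Xs}" "\<lambda>i. \<iota> i \<cdot> \<pi> i" X] by simp
qed

lemma retract_through:
  assumes "arr Y S u" "arr S Y v" "v \<cdot> u = idn C Y" "idn C S \<in> through X S S"
  shows "idn C Y \<in> through X Y Y"
  using through_cmp_right[OF _ assms(1) through_cmp_left[OF _ assms(2,4)]] assms arrD cmp_idn_right
  by metis

lemma biproduct_pairI:
  assumes "arr Y S i" "arr Z S j" "arr S Y p" "arr S Z q"
    and "p \<cdot> i = idn C Y" "q \<cdot> j = idn C Z" "p \<cdot> j = nul Z Y" "q \<cdot> i = nul Y Z"
    and "i \<cdot> p \<oplus>\<^bsub>Hom C S S\<^esub> j \<cdot> q = idn C S"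
  shows "biproduct C [Y, Z] S (\<lambda>k. if k = 0 then i else j) (\<lambda>k. if k = 0 then p else q)"
proof -
  interpret abelian_group "Hom C S S" using assms arrD Hom_abelian_group by blast
  have "i \<cdot> p \<in> Mor C S S" "j \<cdot> q \<in> Mor C S S"
    using assms arr_cmp arrD(3) by blast+
  moreover have "{..<length [Y, Z]} = {1, 0}" by auto
  ultimately have "(\<Oplus>\<^bsub>Hom C S S\<^esub>k\<in>{..<length [Y, Z]}.
      (if k = 0 then i else j) \<cdot> (if k = 0 then p else q)) = idn C S"
    using assms(9) by (simp add: a_comm)
  then show ?thesis
    unfolding biproduct_def using assms by (auto simp: arr_def less_Suc_eq)
qed

lemma direct_summandE:
  assumes "direct_summand C Y X"
  obtains u v where "arr Y X u" "arr X Y v" "v \<cdot> u = idn C Y"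
  using assms biproductD(3-5)[where i = 0] unfolding direct_summand_def direct_sum_def
  by fastforce

lemma add_closure_through:
  assumes "Y \<in> add_closure C X"
  shows "Y \<in> Obj C" "idn C Y \<in> through X Y Y"
proof -
  obtain n S where S: "direct_sum C (replicate n X) S" "direct_summand C Y S"
    using assms by (auto simp: add_closure_def)
  obtain u v where uv: "arr Y S u" "arr S Y v" "v \<cdot> u = idn C Y"
    using S(2) direct_summandE by blast
  obtain \<iota> \<pi> where b: "biproduct C (replicate n X) S \<iota> \<pi>" using S(1) by (auto simp: direct_sum_def)
  show "Y \<in> Obj C" using uv arrD by blast
  have "idn C S \<in> through X S S"
    by (rule biproduct_idn_through[OF b]) (use biproductD(2)[OF b] through_idn in auto)
  then show "idn C Y \<in> through X Y Y" using uv retract_through by blast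
qed

lemma through_vanish:
  assumes "arr Y Z f" "idn C Y \<in> through X Y Y" "\<And>g. arr X Z g \<Longrightarrow> g = nul X Z"
  shows "f = nul Y Z"
proof (rule through_nul)
  show "f \<in> through X Y Z"
    using through_cmp_left[OF arrD(1)[OF assms(1)] assms(1,2)] cmp_idn_right[OF assms(1)] by simp
  show "b \<cdot> a = nul Y Z" if "arr Y X a" "arr X Z b" for a b
    using that assms cmp_nul_left arrD by metis
qed (use assms arrD in auto)

end

text \<open>The terms of a sum of composites through \<open>X\<close> are the components of one composite
  through a power of \<open>X\<close>.\<close>
lemma (in additive_linear_category) through_factors:
  assumes "h \<in> through X Y Z" "X \<in> Obj C" "Y \<in> Obj C" "Z \<in> Obj C"
  obtains n P u v where "direct_sum C (replicate n X) P" "arr Y P u" "arr P Z v" "h = v \<cdot> u"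
proof -
  obtain n :: nat and a b where ab: "\<And>i. arr Y X (a i)" "\<And>i. arr X Z (b i)"
    "h = (\<Oplus>\<^bsub>Hom C Y Z\<^esub>i\<in>{..<n}. b i \<cdot> a i)"
    using throughE[OF assms] by blast
  obtain P where P: "direct_sum C (replicate n X) P"
    using direct_sum_exists[of "replicate n X"] assms(2) by fastforce
  then obtain \<iota> \<pi> where b: "biproduct C (replicate n X) P \<iota> \<pi>" by (auto simp: direct_sum_def)
  obtain u where u: "arr Y P u" "\<And>i. i < n \<Longrightarrow> \<pi> i \<cdot> u = a i"
    using biproduct_induced[OF b assms(3), of a] ab by auto
  obtain v where v: "arr P Z v" "\<And>i. i < n \<Longrightarrow> v \<cdot> \<iota> i = b i"
    using biproduct_coinduced[OF b assms(4), of b] ab by auto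
  have "v \<cdot> u = (\<Oplus>\<^bsub>Hom C Y Z\<^esub>i\<in>{..<n}. v \<cdot> \<iota> i \<cdot> (\<pi> i \<cdot> u))"
    using biproduct_cmp[OF b u(1) v(1)] by simp
  also have "\<dots> = h" unfolding ab(3)
    using u(2) v(2) arr_cmp[OF ab(1,2)] assms(3,4) by (intro finsum_cong_arr) auto
  finally show thesis using that P u v by metis
qed

section \<open>Exact triangles\<close>

lemma (in linear_category) eq_if_diff_nul:
  assumes "arr X Y f" "arr X Y g" "f \<oplus>\<^bsub>Hom C X Y\<^esub> (\<ominus>\<^bsub>Hom C X Y\<^esub> g) = nul X Y"
  shows "f = g"
  using add_assoc[OF assms(1) arr_neg[OF assms(2)] assms(2)] assms add_nul nul_add neg_add by metis

lemma (in additive_linear_category) zero_object_exists: obtains Z where "zero_object C Z"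
proof -
  obtain Z \<iota> \<pi> where "biproduct C [] Z \<iota> \<pi>"
    using direct_sum_exists[of "[]"] by (auto simp: direct_sum_def)
  then have Z: "Z \<in> Obj C" "(\<Oplus>\<^bsub>Hom C Z Z\<^esub>i\<in>{}. \<iota> i \<cdot> \<pi> i) = idn C Z"
    by (auto simp: biproduct_def)
  interpret abelian_group "Hom C Z Z" using Z Hom_abelian_group by blast
  show thesis using that[of Z] Z by (simp add: zero_object_iff)
qed

context triangulated_linear_category
begin

lemma shift_obj: "X \<in> Obj C \<Longrightarrow> shO C X \<in> Obj C"
  using shift_Obj by (auto simp: bij_betw_def)

lemma shift_arr: "arr X Y f \<Longrightarrow> arr (shO C X) (shO C Y) (shM C f)"
  using shift_Mor[of X Y] linear_mapsD(1)[of "shM C"] by (auto simp: arr_def shift_obj linear_isos_def)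

lemma shift_full:
  assumes "arr (shO C X) (shO C Y) f" "X \<in> Obj C" "Y \<in> Obj C"
  obtains g where "arr X Y g" "f = shM C g"
  using shift_Mor[OF assms(2,3)] assms that
  by (auto simp: linear_isos_def arr_def bij_betw_def image_iff)

lemma shift_faithful: "\<lbrakk>arr X Y f; arr X Y g; shM C f = shM C g\<rbrakk> \<Longrightarrow> f = g"
  using shift_Mor[of X Y] by (auto simp: linear_isos_def arr_def bij_betw_def inj_on_def)

lemma shift_cmp_arr: "\<lbrakk>arr X Y f; arr Y Z g\<rbrakk> \<Longrightarrow> shM C (g \<cdot> f) = shM C g \<cdot> shM C f"
  using shift_cmp[of X Y Z f g] by (auto simp: arr_def)

lemma shift_nul:
  assumes "X \<in> Obj C" "Y \<in> Obj C"
  shows "shM C (nul X Y) = nul (shO C X) (shO C Y)"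
proof -
  interpret abelian_group_hom "Hom C X Y" "Hom C (shO C X) (shO C Y)" "shM C"
    using assms shift_Mor[of X Y] shift_obj
    by (intro linear_maps_group_hom[of _ K] Hom_abelian_group) (auto simp: linear_isos_def)
  show ?thesis by (rule hom_zero)
qed

lemma unshift_obj: "X \<in> Obj C \<Longrightarrow> unshift C X \<in> Obj C"
  and shift_unshift: "X \<in> Obj C \<Longrightarrow> shO C (unshift C X) = X"
  using shift_Obj the_inv_into_into[of "shO C" "Obj C" X "Obj C"]
  by (auto simp: unshift_def bij_betw_def f_the_inv_into_f)

lemma shift_zero_object: "zero_object C X \<Longrightarrow> zero_object C (shO C X)"
  using shift_idn[of X] shift_nul[of X X] by (auto simp: zero_object_iff shift_obj)

lemma tri_arr:
  assumes "tri C X Y Z f g h" shows "arr X Y f" "arr Y Z g" "arr Z (shO C X) h"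
  using tri_closed[OF assms] by (auto simp: arr_def shift_obj)

lemma tri_obj:
  assumes "tri C X Y Z f g h" shows "X \<in> Obj C" "Y \<in> Obj C" "Z \<in> Obj C"
  using tri_closed[OF assms] by auto

lemma tri_cone:
  assumes "arr X Y f" obtains Z g h where "tri C X Y Z f g h"
  using TR1_cone[OF arrD[OF assms]] by blast

lemma tri_rotate:
  assumes "tri C X Y Z f g h"
  shows "tri C Y Z (shO C X) g h (\<ominus>\<^bsub>Hom C (shO C X) (shO C Y)\<^esub> shM C f)"
  using TR2 tri_closed[OF assms] assms by blast

text \<open>Compare with the trivial triangle on \<open>id\<close>: the third component of the morphism
  \<open>(id, f)\<close> starts at a zero object.\<close>
lemma tri_cmp:
  assumes "tri C X Y Z f g h" shows "g \<cdot> f = nul X Z"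
proof -
  note ar = tri_arr[OF assms]
  obtain O' where O': "zero_object C O'" using zero_object_exists .
  have X: "X \<in> Obj C" using tri_obj[OF assms] by simp
  have "f \<cdot> idn C X = f \<cdot> idn C X" ..
  then obtain c where "c \<in> Mor C O' Z" "c \<cdot> nul X O' = g \<cdot> f"
    using TR3[OF TR1_idn[OF X O'] assms, of "idn C X" f] arrD(3)[OF arr_idn[OF X]] arrD(3)[OF ar(1)]
    by auto
  moreover have "arr O' Z c"
    using calculation(1) O' tri_obj[OF assms] by (auto simp: arr_def zero_object_def)
  ultimately show ?thesis using cmp_nul_right X by metis
qed

lemma tri_cmp_shift:
  assumes "tri C X Y Z f g h" shows "shM C f \<cdot> h = nul Z (shO C Y)"
proof -
  note ar = tri_arr[OF assms]
  have "(\<ominus>\<^bsub>Hom C (shO C X) (shO C Y)\<^esub> shM C f) \<cdot> h = nul Z (shO C Y)"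
    using tri_cmp[OF tri_rotate[OF tri_rotate[OF assms]]] .
  then have "\<ominus>\<^bsub>Hom C Z (shO C Y)\<^esub> (shM C f \<cdot> h) = nul Z (shO C Y)"
    using cmp_neg_left[OF ar(3) shift_arr[OF ar(1)]] by simp
  then show ?thesis
    using neg_neg[OF arr_cmp[OF ar(3) shift_arr[OF ar(1)]]] neg_nul tri_obj[OF assms] shift_obj by metis
qed

text \<open>Exactness of \<open>Hom(-, W)\<close>: the pair \<open>(0, u)\<close> is a morphism to the triangle
  \<open>0 \<rightarrow> W \<rightarrow> W \<rightarrow> 0\<close>, and its third component is the extension.\<close>
lemma tri_extend:
  assumes "tri C X Y Z f g h" "arr Y W u" "u \<cdot> f = nul X W"
  obtains v where "arr Z W v" "u = v \<cdot> g"
proof -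
  note ar = tri_arr[OF assms(1)]
  obtain O' where O': "zero_object C O'" using zero_object_exists .
  then have obj: "O' \<in> Obj C" "W \<in> Obj C" "X \<in> Obj C" "Z \<in> Obj C"
    using O' tri_obj[OF assms(1)] arrD[OF assms(2)] by (simp_all add: zero_object_iff)
  have "tri C W W (shO C O') (idn C W) (nul W (shO C O')) (nul (shO C O') (shO C W))"
    by (intro TR1_idn shift_zero_object O' obj)
  then have "tri C O' W W (nul O' W) (idn C W) (nul W (shO C O'))"
    using TR2[OF obj(1,2,2), of "nul O' W" "idn C W" "nul W (shO C O')"] obj
      arrD(3)[OF arr_nul] arrD(3)[OF arr_idn] shift_nul neg_nul shift_obj by simp
  moreover have "u \<cdot> f = nul O' W \<cdot> nul X O'"
    using assms(3) cmp_nul_right[OF arr_nul] obj by simp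
  ultimately obtain c where "c \<in> Mor C Z W" "c \<cdot> g = idn C W \<cdot> u"
    using TR3[OF assms(1), of O' W W "nul O' W" "idn C W" "nul W (shO C O')" "nul X O'" u]
      arrD(3)[OF arr_nul] arrD(3)[OF assms(2)] obj by blast
  then show thesis using that[of c] obj cmp_idn_left[OF assms(2)] by (auto simp: arr_def)
qed

text \<open>Exactness of \<open>Hom(W, -)\<close>. As axiom TR3 supplies only the third component of a morphism,
  the triangles are rotated so that the lift appears there, up to shift and sign.\<close>
lemma tri_lift:
  assumes "tri C X Y Z f g h" "arr W Y u" "g \<cdot> u = nul W Z"
  obtains v where "arr W X v" "u = f \<cdot> v"
proof -
  note ar = tri_arr[OF assms(1)]
  obtain O' where O': "zero_object C O'" using zero_object_exists .
  then have obj: "O' \<in> Obj C" "W \<in> Obj C" "X \<in> Obj C" "Y \<in> Obj C" "Z \<in> Obj C"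
    using O' tri_obj[OF assms(1)] arrD[OF assms(2)] by (simp_all add: zero_object_iff)
  have "nul O' Z \<cdot> nul W O' = g \<cdot> u"
    using assms(3) cmp_nul_right[OF arr_nul] obj by simp
  then obtain c where c: "c \<in> Mor C (shO C W) (shO C X)"
    "shM C u \<cdot> (\<ominus>\<^bsub>Hom C (shO C W) (shO C W)\<^esub> shM C (idn C W)) =
      (\<ominus>\<^bsub>Hom C (shO C X) (shO C Y)\<^esub> shM C f) \<cdot> c"
    using TR3[OF tri_rotate[OF TR1_idn[OF obj(2) O']] tri_rotate[OF assms(1)], of u "nul O' Z"]
      arrD(3)[OF arr_nul] arrD(3)[OF assms(2)] obj by blast
  obtain v where v: "arr W X v" "c = shM C v"
    using shift_full[of W X c] c(1) obj by (auto simp: arr_def shift_obj)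
  have su: "arr (shO C W) (shO C Y) (shM C u)" using shift_arr[OF assms(2)] .
  have "shM C u \<cdot> (\<ominus>\<^bsub>Hom C (shO C W) (shO C W)\<^esub> shM C (idn C W)) =
      \<ominus>\<^bsub>Hom C (shO C W) (shO C Y)\<^esub> shM C u"
    using cmp_neg_right[OF arr_idn su] cmp_idn_right[OF su] shift_idn shift_obj obj by simp
  moreover have "(\<ominus>\<^bsub>Hom C (shO C X) (shO C Y)\<^esub> shM C f) \<cdot> c =
      \<ominus>\<^bsub>Hom C (shO C W) (shO C Y)\<^esub> shM C (f \<cdot> v)"
    using cmp_neg_left[OF shift_arr shift_arr] v ar(1) shift_cmp_arr by simp
  ultimately have "shM C u = shM C (f \<cdot> v)"
    using c(2) neg_neg[OF su] neg_neg[OF shift_arr[OF arr_cmp[OF v(1) ar(1)]]] by metis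
  then have "u = f \<cdot> v" using shift_faithful assms(2) arr_cmp[OF v(1) ar(1)] by blast
  then show thesis using that v by blast
qed

text \<open>Exactness of \<open>Hom(-, W)\<close> at the first vertex, phrased with the connecting map so that no
  triangle has to be shifted back.\<close>
lemma tri_extend_shift:
  assumes "tri C X Y Z f g h" "arr X W u" "shM C u \<cdot> h = nul Z (shO C W)"
  obtains v where "arr Y W v" "u = v \<cdot> f"
proof -
  note ar = tri_arr[OF assms(1)]
  have obj: "W \<in> Obj C" "X \<in> Obj C" "Y \<in> Obj C"
    using tri_obj[OF assms(1)] arrD[OF assms(2)] by simp_all
  obtain w where w: "arr (shO C Y) (shO C W) w"
      "shM C u = w \<cdot> (\<ominus>\<^bsub>Hom C (shO C X) (shO C Y)\<^esub> shM C f)"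
    using tri_extend[OF tri_rotate[OF tri_rotate[OF assms(1)]] shift_arr[OF assms(2)] assms(3)] .
  obtain v where v: "arr Y W v" "\<ominus>\<^bsub>Hom C (shO C Y) (shO C W)\<^esub> w = shM C v"
    using shift_full[OF arr_neg[OF w(1)]] obj by blast
  have "shM C u = shM C (v \<cdot> f)"
    using w v cmp_neg_right[OF shift_arr[OF ar(1)] w(1)] cmp_neg_left[OF shift_arr[OF ar(1)] w(1)]
      shift_cmp_arr[OF ar(1) v(1)] by simp
  then have "u = v \<cdot> f" using shift_faithful assms(2) arr_cmp[OF ar(1) v(1)] by blast
  then show thesis using that v by blast
qed

text \<open>Idempotents split along cones. If \<open>u\<close> has a retraction \<open>v\<close>, the connecting map \<open>h\<close> is
  zero, so \<open>g\<close> has a section \<open>k\<close>, and \<open>k - u v k\<close> is a section that \<open>v\<close> annihilates.\<close>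
lemma split_mono_direct_sum:
  assumes "tri C Y P Q u g h" "arr P Y v" "v \<cdot> u = idn C Y"
  shows "direct_sum C [Y, Q] P"
proof -
  note ar = tri_arr[OF assms(1)]
  have obj: "Y \<in> Obj C" "P \<in> Obj C" "Q \<in> Obj C" using tri_obj[OF assms(1)] .
  have "h = shM C (v \<cdot> u) \<cdot> h"
    using assms(3) shift_idn[OF obj(1)] cmp_idn_left[OF ar(3)] by simp
  also have "\<dots> = shM C v \<cdot> (shM C u \<cdot> h)"
    using shift_cmp_arr[OF ar(1) assms(2)] assoc[OF ar(3) shift_arr shift_arr] ar(1) assms(2) by simp
  also have "\<dots> = nul Q (shO C Y)"
    using tri_cmp_shift[OF assms(1)] cmp_nul_right[OF shift_arr[OF assms(2)] obj(3)] by simp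
  finally have h: "h = nul Q (shO C Y)" .
  obtain k where k: "arr Q P k" "idn C Q = g \<cdot> k"
    using tri_lift[OF tri_rotate[OF assms(1)] arr_idn[OF obj(3)]] cmp_idn_right[OF ar(3)] h by auto
  define j where "j = k \<oplus>\<^bsub>Hom C Q P\<^esub> (\<ominus>\<^bsub>Hom C Q P\<^esub> (u \<cdot> (v \<cdot> k)))"
  have uvk: "arr Q P (u \<cdot> (v \<cdot> k))" and vk: "arr Q Y (v \<cdot> k)"
    using arr_cmp[OF arr_cmp[OF k(1) assms(2)] ar(1)] arr_cmp[OF k(1) assms(2)] .
  have j: "arr Q P j" unfolding j_def using k uvk by (intro arr_add arr_neg)
  have gu: "g \<cdot> u = nul Y Q" using tri_cmp[OF assms(1)] .
  have gj: "g \<cdot> j = idn C Q"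
  proof -
    have "g \<cdot> (u \<cdot> (v \<cdot> k)) = nul Q Q"
      using assoc[OF vk ar(1,2)] gu cmp_nul_left[OF vk] obj by simp
    then have "g \<cdot> j = g \<cdot> k \<oplus>\<^bsub>Hom C Q Q\<^esub> nul Q Q"
      unfolding j_def using cmp_add_right[OF k(1) arr_neg[OF uvk] ar(2)] cmp_neg_right[OF uvk ar(2)]
        neg_nul obj by simp
    then show ?thesis using k add_nul[OF arr_idn[OF obj(3)]] by simp
  qed
  have vj: "v \<cdot> j = nul Q Y"
  proof -
    have "v \<cdot> (u \<cdot> (v \<cdot> k)) = v \<cdot> k"
      using assoc[OF vk ar(1) assms(2)] assms(3) cmp_idn_left[OF vk] by simp
    then show ?thesis
      unfolding j_def using cmp_add_right[OF k(1) arr_neg[OF uvk] assms(2)]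
        cmp_neg_right[OF uvk assms(2)] add_neg[OF vk] by simp
  qed
  \<comment> \<open>The difference \<open>d\<close> of \<open>id\<close> and \<open>e\<close> is annihilated by \<open>g\<close>, hence is of the form \<open>u w\<close>;
    since also \<open>v d = 0\<close>, it vanishes.\<close>
  define e where "e = u \<cdot> v \<oplus>\<^bsub>Hom C P P\<^esub> j \<cdot> g"
  define d where "d = idn C P \<oplus>\<^bsub>Hom C P P\<^esub> (\<ominus>\<^bsub>Hom C P P\<^esub> e)"
  have uv: "arr P P (u \<cdot> v)" and jg: "arr P P (j \<cdot> g)" 
    using arr_cmp[OF assms(2) ar(1)] arr_cmp[OF ar(2) j] .
  have e: "arr P P e" unfolding e_def using uv jg by (rule arr_add)
  have d: "arr P P d" unfolding d_def using e arr_idn obj by (intro arr_add arr_neg) auto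
  have "g \<cdot> e = g \<cdot> (u \<cdot> v) \<oplus>\<^bsub>Hom C P Q\<^esub> g \<cdot> (j \<cdot> g)"
    unfolding e_def using uv jg ar(2) by (rule cmp_add_right)
  then have "g \<cdot> e = g"
    using assoc[OF assms(2) ar(1,2)] assoc[OF ar(2) j ar(2)] gu gj cmp_idn_left[OF ar(2)]
      cmp_nul_left[OF assms(2) obj(3)] nul_add[OF ar(2)] by simp
  then have gd: "g \<cdot> d = nul P Q"
    unfolding d_def using cmp_add_right[OF arr_idn[OF obj(2)] arr_neg[OF e] ar(2)]
      cmp_neg_right[OF e ar(2)] cmp_idn_right[OF ar(2)] add_neg[OF ar(2)] by simp
  have "v \<cdot> e = v \<cdot> (u \<cdot> v) \<oplus>\<^bsub>Hom C P Y\<^esub> v \<cdot> (j \<cdot> g)"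
    unfolding e_def using uv jg assms(2) by (rule cmp_add_right)
  then have "v \<cdot> e = v"
    using assoc[OF assms(2) ar(1) assms(2)] assoc[OF ar(2) j assms(2)] assms(3) vj
      cmp_idn_left[OF assms(2)] cmp_nul_left[OF ar(2) obj(1)] add_nul[OF assms(2)] by simp
  then have vd: "v \<cdot> d = nul P Y"
    unfolding d_def using cmp_add_right[OF arr_idn[OF obj(2)] arr_neg[OF e] assms(2)]
      cmp_neg_right[OF e assms(2)] cmp_idn_right[OF assms(2)] add_neg[OF assms(2)] by simp
  obtain w where w: "arr P Y w" "d = u \<cdot> w"
    using tri_lift[OF assms(1) d gd] .
  have "w = nul P Y"
    using vd w assoc[OF w(1) ar(1) assms(2)] assms(3) cmp_idn_left[OF w(1)] by simp
  then have "d = nul P P" using w cmp_nul_right[OF ar(1) obj(2)] by simp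
  then have "e = idn C P"
    using eq_if_diff_nul[OF arr_idn[OF obj(2)] e] by (simp add: d_def)
  then show ?thesis
    using biproduct_pairI[OF ar(1) j assms(2) ar(2) assms(3) gj vj gu] by (auto simp: e_def direct_sum_def)
qed

text \<open>A finite sum of composites \<open>Y \<rightarrow> X \<rightarrow> Y\<close> equal to the identity exhibits \<open>Y\<close> as a retract
  of a power of \<open>X\<close>, and retracts are direct summands by \<open>split_mono_direct_sum\<close>.\<close>
lemma add_closure_iff:
  assumes "X \<in> Obj C"
  shows "Y \<in> add_closure C X \<longleftrightarrow> Y \<in> Obj C \<and> idn C Y \<in> through X Y Y"
proof
  assume *: "Y \<in> Obj C \<and> idn C Y \<in> through X Y Y"
  then obtain n P u v where P: "direct_sum C (replicate n X) P" "arr Y P u" "arr P Y v"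
      "idn C Y = v \<cdot> u"
    using through_factors[of "idn C Y" X Y Y] assms by blast
  obtain Q g h where "tri C Y P Q u g h"
    using tri_cone[OF P(2)] .
  then have "direct_sum C [Y, Q] P" using split_mono_direct_sum P by metis
  then show "Y \<in> add_closure C X" using P by (auto simp: add_closure_def direct_summand_def)
qed (use add_closure_through in blast)

end

section \<open>Vanishing of morphism spaces\<close>

context linear_category
begin

definition Hom_vanishes :: "'o \<Rightarrow> 'o \<Rightarrow> bool"
  where "Hom_vanishes X Y \<longleftrightarrow> (\<forall>f. arr X Y f \<longrightarrow> f = nul X Y)"

lemma Hom_vanishesD: "\<lbrakk>Hom_vanishes X Y; arr X Y f\<rbrakk> \<Longrightarrow> f = nul X Y"
  by (simp add: Hom_vanishes_def)

lemma Hom_vanishes_iff: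
  "\<lbrakk>X \<in> Obj C; Y \<in> Obj C\<rbrakk> \<Longrightarrow> Hom_vanishes X Y \<longleftrightarrow> Mor C X Y = {nul X Y}"
  using arrD(3)[OF arr_nul, of X Y] by (auto simp: Hom_vanishes_def arr_def)

lemma Hom_vanishes_through:
  "\<lbrakk>Hom_vanishes X Z; idn C Y \<in> through X Y Y\<rbrakk> \<Longrightarrow> Hom_vanishes Y Z"
  using through_vanish unfolding Hom_vanishes_def by blast

lemma biproduct_summand_through:
  assumes "biproduct C Xs S \<iota> \<pi>" "i < length Xs"
  shows "idn C (Xs ! i) \<in> through S (Xs ! i) (Xs ! i)"
  using through_single[OF biproductD(3,4)[OF assms]] biproductD(5)[OF assms] by simp

lemma Hom_vanishes_direct_sum:
  assumes "direct_sum C Xs S" "\<And>X. X \<in> set Xs \<Longrightarrow> Hom_vanishes X Z"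
  shows "Hom_vanishes S Z"
  unfolding Hom_vanishes_def
proof (intro allI impI)
  fix f assume f: "arr S Z f"
  obtain \<iota> \<pi> where b: "biproduct C Xs S \<iota> \<pi>" using assms(1) by (auto simp: direct_sum_def)
  note bi = biproductD[OF b]
  have Z: "Z \<in> Obj C" using arrD(2)[OF f] .
  interpret abelian_group "Hom C S Z" using Hom_abelian_group[OF bi(1) Z] .
  have "f = (\<Oplus>\<^bsub>Hom C S Z\<^esub>i\<in>{..<length Xs}. f \<cdot> \<iota> i \<cdot> (\<pi> i \<cdot> idn C S))"
    using biproduct_cmp[OF b arr_idn[OF bi(1)] f] cmp_idn_right[OF f] by simp
  also have "\<dots> = (\<Oplus>\<^bsub>Hom C S Z\<^esub>i\<in>{..<length Xs}. nul S Z)"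
  proof (rule finsum_cong_arr[OF bi(1) Z])
    fix i assume "i \<in> {..<length Xs}"
    then have i: "i < length Xs" by simp
    have "f \<cdot> \<iota> i = nul (Xs ! i) Z"
      using Hom_vanishesD[OF assms(2)[OF nth_mem[OF i]] arr_cmp[OF bi(3)[OF i] f]] .
    then show "f \<cdot> \<iota> i \<cdot> (\<pi> i \<cdot> idn C S) = nul S Z"
      using cmp_idn_right cmp_nul_left bi(4)[OF i] Z by simp
  qed (rule arr_nul[OF bi(1) Z])
  finally show "f = nul S Z" by simp
qed

section \<open>Approximations\<close>

text \<open>A map that is universal for maps to \<open>X\<close> is universal for maps to every object of
  \<open>add X\<close>.\<close>
lemma factors_extend:
  assumes t: "arr A B t" and X: "\<And>u. arr A X u \<Longrightarrow> \<exists>v. arr B X v \<and> u = v \<cdot> t"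
    and W: "idn C W \<in> through X W W" and w: "arr A W w"
  shows "\<exists>v. arr B W v \<and> w = v \<cdot> t"
proof -
  have obj: "A \<in> Obj C" "B \<in> Obj C" "W \<in> Obj C" using arrD[OF t] arrD[OF w] by simp_all
  have "w \<in> through X A W"
    using through_cmp_right[OF obj(3) w W] cmp_idn_left[OF w] by simp
  then show ?thesis
  proof induction
    case zero
    then show ?case using cmp_nul_left[OF t] arr_nul obj by metis
  next
    case (step a b h)
    obtain v where v: "arr B W v" "h = v \<cdot> t" using step.IH by blast
    obtain v' where v': "arr B X v'" "a = v' \<cdot> t" using X[OF step(1)] by blast
    have bv: "arr B W (b \<cdot> v')" using arr_cmp[OF v'(1) step(2)] .
    have "b \<cdot> a \<oplus>\<^bsub>Hom C A W\<^esub> h = (b \<cdot> v' \<oplus>\<^bsub>Hom C B W\<^esub> v) \<cdot> t"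
      using v v' assoc[OF t v'(1) step(2)] cmp_add_left[OF t bv v(1)] by simp
    then show ?case using arr_add[OF bv v(1)] by blast
  qed
qed

end

text \<open>A finite generating set of \<open>Hom(A, B)\<close>, taken as the components of a map to a power of
  \<open>B\<close>, yields all other maps \<open>A \<rightarrow> B\<close> as linear combinations of the components.\<close>
lemma (in additive_linear_category) power_approximation:
  assumes "Hom_finite K C" "A \<in> Obj C" "B \<in> Obj C"
  obtains n P t where "direct_sum C (replicate n B) P" "arr A P t"
    "\<And>u. arr A B u \<Longrightarrow> \<exists>v. arr P B v \<and> u = v \<cdot> t"
proof -
  interpret AB: module K "Hom C A B" using Hom_module assms by blast
  obtain G where G: "finite G" "G \<subseteq> Mor C A B" "lin_span K (Hom C A B) G = Mor C A B"
    using AB.finite_dimensional_lin_span assms unfolding Hom_finite_def by blast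
  obtain gs where gs: "set gs = G" using finite_list[OF G(1)] by blast
  obtain P where P: "direct_sum C (replicate (length gs) B) P"
    using direct_sum_exists[of "replicate (length gs) B"] assms(3) by fastforce
  then obtain \<iota> \<pi> where b: "biproduct C (replicate (length gs) B) P \<iota> \<pi>"
    by (auto simp: direct_sum_def)
  have g: "arr A B (gs ! i)" if "i < length gs" for i
    using nth_mem[OF that] G(2) gs assms by (auto simp: arr_def)
  obtain t where t: "arr A P t" "\<And>i. i < length gs \<Longrightarrow> \<pi> i \<cdot> t = gs ! i"
    using biproduct_induced[OF b assms(2), of "\<lambda>i. gs ! i"] g by auto
  have P': "P \<in> Obj C" using arrD[OF t(1)] by simp
  interpret PB: module K "Hom C P B" using Hom_module P' assms by blast
  have lin: "(\<lambda>g. g \<cdot> t) \<in> linear_maps K (Hom C P B) (Hom C A B)"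
    using cmp_linear_left arrD[OF t(1)] assms by blast
  have "\<exists>v. arr P B v \<and> u = v \<cdot> t" if "arr A B u" for u
  proof -
    have "u \<in> lin_span K (Hom C A B) G" using that G by (simp add: arr_def)
    then show ?thesis
    proof induction
      case zero
      then show ?case using cmp_nul_left[OF t(1)] arr_nul P' assms by metis
    next
      case (step a d u)
      then obtain i where i: "i < length gs" "d = gs ! i" using gs by (metis in_set_conv_nth)
      obtain v where v: "arr P B v" "u = v \<cdot> t" using step.IH by blast
      have p: "arr P B (\<pi> i)" using biproductD(4)[OF b, of i] i by simp
      have ap: "arr P B (a \<odot>\<^bsub>Hom C P B\<^esub> \<pi> i)"
        using step(1) arrD[OF p] by (auto intro!: arrI)
      have "a \<odot>\<^bsub>Hom C A B\<^esub> d \<oplus>\<^bsub>Hom C A B\<^esub> u = (a \<odot>\<^bsub>Hom C P B\<^esub> \<pi> i \<oplus>\<^bsub>Hom C P B\<^esub> v) \<cdot> t"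
        using linear_mapsD(3)[OF lin step(1) arrD(3)[OF p]] t(2)[OF i(1)] i(2) v(2)
          cmp_add_left[OF t(1) ap v(1)] by simp
      then show ?case using arr_add[OF ap v(1)] by blast
    qed
  qed
  then show thesis using that P t(1) by blast
qed

section \<open>Symmetry of vanishing extensions\<close>
lemma dual_module_trivial:
  assumes "cring K" "module K V" "carrier V = {\<zero>\<^bsub>V\<^esub>}"
    and "\<phi> \<in> carrier (dual_module K V)" "\<psi> \<in> carrier (dual_module K V)"
  shows "\<phi> = \<psi>"
proof -
  interpret module K V by fact
  have zero: "\<xi> \<zero>\<^bsub>V\<^esub> = \<zero>\<^bsub>K\<^esub>" if "\<xi> \<in> carrier (dual_module K V)" for \<xi>
  proof -
    have \<xi>: "\<xi> \<in> linear_maps K V (self_module K)" using that by (simp add: dual_module_def)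
    have "\<xi> (\<zero>\<^bsub>K\<^esub> \<odot>\<^bsub>V\<^esub> \<zero>\<^bsub>V\<^esub>) = \<zero>\<^bsub>K\<^esub> \<otimes>\<^bsub>K\<^esub> \<xi> \<zero>\<^bsub>V\<^esub>"
      using linear_mapsD(3)[OF \<xi>, of "\<zero>\<^bsub>K\<^esub>" "\<zero>\<^bsub>V\<^esub>"] by (simp add: self_module_def)
    moreover have "\<xi> \<zero>\<^bsub>V\<^esub> \<in> carrier K"
      using linear_mapsD(1)[OF \<xi>, of "\<zero>\<^bsub>V\<^esub>"] by (simp add: self_module_def)
    ultimately show ?thesis by simp
  qed
  moreover have "\<phi> \<in> extensional {\<zero>\<^bsub>V\<^esub>}" "\<psi> \<in> extensional {\<zero>\<^bsub>V\<^esub>}"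
    using assms by (auto simp: dual_module_def)
  ultimately show ?thesis
    using zero[OF assms(4)] zero[OF assms(5)] by (intro extensionalityI[of \<phi> _ \<psi>]) auto
qed

context triangulated_linear_category
begin

lemma Hom_vanishes_shift:
  assumes "Hom_vanishes X Y" "X \<in> Obj C" "Y \<in> Obj C"
  shows "Hom_vanishes (shO C X) (shO C Y)"
  unfolding Hom_vanishes_def
proof (intro allI impI)
  fix f assume "arr (shO C X) (shO C Y) f"
  then obtain g where "arr X Y g" "f = shM C g" using shift_full assms by blast
  then show "f = nul (shO C X) (shO C Y)"
    using Hom_vanishesD[OF assms(1)] shift_nul[OF assms(2,3)] by blast
qed

lemma Hom_vanishes_unshift:
  assumes "Hom_vanishes (shO C X) (shO C Y)" "X \<in> Obj C" "Y \<in> Obj C"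
  shows "Hom_vanishes X Y"
  unfolding Hom_vanishes_def
proof (intro allI impI)
  fix f assume f: "arr X Y f"
  have "shM C f = shM C (nul X Y)"
    using Hom_vanishesD[OF assms(1) shift_arr[OF f]] shift_nul[OF assms(2,3)] by simp
  then show "f = nul X Y" using shift_faithful[OF f arr_nul] assms by blast
qed

text \<open>\<open>Hom(B, A[1])\<close> embeds into the dual of \<open>Hom(A[1], B[2])\<close>, which is zero because
  \<open>Hom(A, B[1])\<close> is.\<close>
lemma Ext_symmetric:
  assumes CY: "Calabi_Yau_2 K C" and "A \<in> Obj C" "B \<in> Obj C" "Hom_vanishes A (shO C B)"
  shows "Hom_vanishes B (shO C A)"
proof -
  define V where "V = Hom C (shO C A) (shO C (shO C B))"
  have obj: "shO C A \<in> Obj C" "shO C B \<in> Obj C" "shO C (shO C B) \<in> Obj C"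
    using assms shift_obj by blast+
  have K: "cring K" using field_K by (simp add: field.axioms(1) fieldE(1))
  have "Hom_vanishes (shO C A) (shO C (shO C B))"
    using Hom_vanishes_shift assms obj by blast
  then have V: "carrier V = {\<zero>\<^bsub>V\<^esub>}" "module K V"
    unfolding V_def using Hom_vanishes_iff Hom_module obj by blast+
  obtain \<Phi> where "\<forall>X\<in>Obj C. \<forall>Y\<in>Obj C.
      \<Phi> X Y \<in> linear_isos K (Hom C X Y) (dual_module K (Hom C Y (shO C (shO C X))))"
    using CY unfolding Calabi_Yau_2_def by blast
  then have \<Phi>: "\<Phi> B (shO C A) \<in> linear_isos K (Hom C B (shO C A)) (dual_module K V)"
    using assms(3) obj(1) by (simp add: V_def)
  have "f = g" if "arr B (shO C A) f" "arr B (shO C A) g" for f g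
  proof -
    have "\<Phi> B (shO C A) f = \<Phi> B (shO C A) g"
      using \<Phi> that by (intro dual_module_trivial[OF K V(2,1)])
        (auto simp: linear_isos_def arr_def bij_betw_def)
    then show ?thesis
      using \<Phi> that by (auto simp: linear_isos_def arr_def bij_betw_def inj_on_def)
  qed
  then show ?thesis using arr_nul[OF assms(3) obj(1)] by (auto simp: Hom_vanishes_def)
qed

text \<open>A map \<open>\<alpha> : Z \<rightarrow> W[1]\<close> vanishes on \<open>B\<close>, hence comes from a map \<open>A[1] \<rightarrow> W[1]\<close>. The
  latter passes through \<open>f[1]\<close>, and \<open>f[1] h = 0\<close>. This applies to each cone of a left
  approximation below.\<close>
lemma Ext_from_cone_vanishes:
  assumes "tri C A B Z f g h" "W \<in> Obj C" "Hom_vanishes B (shO C W)"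
    and "\<And>u. arr A W u \<Longrightarrow> \<exists>v. arr B W v \<and> u = v \<cdot> f"
  shows "Hom_vanishes Z (shO C W)"
  unfolding Hom_vanishes_def
proof (intro allI impI)
  fix \<alpha> assume \<alpha>: "arr Z (shO C W) \<alpha>"
  note ar = tri_arr[OF assms(1)] and obj = tri_obj[OF assms(1)]
  have "\<alpha> \<cdot> g = nul B (shO C W)"
    using Hom_vanishesD[OF assms(3)] arr_cmp[OF ar(2) \<alpha>] by blast
  then obtain \<beta> where \<beta>: "arr (shO C A) (shO C W) \<beta>" "\<alpha> = \<beta> \<cdot> h"
    using tri_extend[OF tri_rotate[OF assms(1)] \<alpha>] by blast
  obtain \<gamma> where \<gamma>: "arr A W \<gamma>" "\<beta> = shM C \<gamma>"
    using shift_full[OF \<beta>(1) obj(1) assms(2)] .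
  obtain \<delta> where \<delta>: "arr B W \<delta>" "\<gamma> = \<delta> \<cdot> f" using assms(4)[OF \<gamma>(1)] by blast
  have "\<alpha> = shM C \<delta> \<cdot> (shM C f \<cdot> h)"
    using \<beta> \<gamma> \<delta> shift_cmp_arr[OF ar(1) \<delta>(1)] assoc[OF ar(3) shift_arr[OF ar(1)] shift_arr[OF \<delta>(1)]]
    by simp
  then show "\<alpha> = nul Z (shO C W)"
    using tri_cmp_shift[OF assms(1)] cmp_nul_right[OF shift_arr[OF \<delta>(1)] obj(3)] by simp
qed

end

context triangulated_linear_category
begin

section \<open>Additive closures and cluster tilting objects\<close>
lemma add_closure_factors:
  assumes "W \<in> add_closure C X" "arr A B t" "arr A W w"
    and "\<And>u. arr A X u \<Longrightarrow> \<exists>v. arr B X v \<and> u = v \<cdot> t"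
  obtains v where "arr B W v" "w = v \<cdot> t"
  using factors_extend[OF assms(2,4) add_closure_through(2)[OF assms(1)] assms(3)] by blast

lemma add_closure_self: "X \<in> Obj C \<Longrightarrow> X \<in> add_closure C X"
  by (simp add: add_closure_iff through_idn)

lemma add_closure_trans:
  assumes "X \<in> add_closure C W" "W \<in> Obj C" shows "add_closure C X \<subseteq> add_closure C W"
proof
  fix Y assume "Y \<in> add_closure C X"
  then have "Y \<in> Obj C" "idn C Y \<in> through X Y Y" using add_closure_through by blast+
  then show "Y \<in> add_closure C W"
    using through_trans[OF add_closure_through(2)[OF assms(1)]] add_closure_iff[OF assms(2)] by blast
qed

lemma add_closure_direct_sum:
  assumes "direct_sum C Xs S" "set Xs \<subseteq> add_closure C W" "W \<in> Obj C"
  shows "S \<in> add_closure C W"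
proof -
  obtain \<iota> \<pi> where b: "biproduct C Xs S \<iota> \<pi>" using assms(1) by (auto simp: direct_sum_def)
  have "idn C S \<in> through W S S"
    using assms(2) by (intro biproduct_idn_through[OF b] add_closure_through(2)) (auto dest: nth_mem)
  then show ?thesis using biproductD(1)[OF b] add_closure_iff[OF assms(3)] by blast
qed

lemma direct_sum_members:
  assumes "direct_sum C Xs S" shows "S \<in> Obj C" "set Xs \<subseteq> add_closure C S"
proof -
  obtain \<iota> \<pi> where b: "biproduct C Xs S \<iota> \<pi>" using assms(1) by (auto simp: direct_sum_def)
  show S: "S \<in> Obj C" using biproductD(1)[OF b] .
  show "set Xs \<subseteq> add_closure C S"
    using biproduct_summand_through[OF b] biproductD(2)[OF b]
    by (auto simp: in_set_conv_nth add_closure_iff[OF S])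
qed

lemma direct_sum_replicate_add_closure:
  assumes "direct_sum C (replicate n X) P" "X \<in> Obj C"
  shows "P \<in> add_closure C X"
  using add_closure_direct_sum[OF assms(1) _ assms(2)] add_closure_self[OF assms(2)]
  by (cases "n = 0") auto

lemma add_closure_Hom_vanishes:
  "\<lbrakk>Y \<in> add_closure C X; Hom_vanishes X Z\<rbrakk> \<Longrightarrow> Hom_vanishes Y Z"
  using Hom_vanishes_through add_closure_through(2) by blast

lemma cluster_tilting_iff:
  "cluster_tilting C T \<longleftrightarrow> T \<in> Obj C \<and>
     (\<forall>X\<in>Obj C. X \<in> add_closure C T \<longleftrightarrow> Hom_vanishes T (shO C X))"
proof -
  have "Hom_vanishes T (shO C X) \<longleftrightarrow> Mor C T (shO C X) = {nul T (shO C X)}"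
    if "T \<in> Obj C" "X \<in> Obj C" for X
    using Hom_vanishes_iff[OF that(1) shift_obj[OF that(2)]] .
  then show ?thesis
    using add_closure_through(1)[of _ T] unfolding cluster_tilting_def by blast
qed

lemma cluster_tilting_cong:
  assumes "cluster_tilting C S" "V \<in> Obj C" "add_closure C V = add_closure C S"
  shows "cluster_tilting C V"
proof -
  have S: "S \<in> Obj C" using assms(1) by (simp add: cluster_tilting_def)
  have "V \<in> add_closure C S" "S \<in> add_closure C V"
    using add_closure_self assms(2,3) S by blast+
  then have "Hom_vanishes S Z \<longleftrightarrow> Hom_vanishes V Z" for Z
    using add_closure_Hom_vanishes by blast
  then show ?thesis using assms unfolding cluster_tilting_iff by blast
qed

section \<open>Rigidity and maximality of the completion\<close>

text \<open>The first two claims are \<open>Ext_from_cone_vanishes\<close> for \<open>W = U\<close> and its mirror image. That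
  lemma does not give the third, since \<open>f\<close> is universal only for maps to \<open>add U\<close>; but rigidity of
  \<open>A\<close> shows that each map \<open>A \<rightarrow> X\<close> comes from a map \<open>A \<rightarrow> U'\<close>.\<close>
lemma complement_Ext_vanishes:
  assumes CY: "Calabi_Yau_2 K C"
    and U: "U \<in> Obj C" "Hom_vanishes U (shO C U)" and A: "Hom_vanishes A (shO C A)"
    and tri: "tri C A U' X f g h" and approx: "left_approximation C U A U' f"
  shows "Hom_vanishes U (shO C X)" "Hom_vanishes X (shO C U)" "Hom_vanishes X (shO C X)"
proof -
  note ar = tri_arr[OF tri] and obj = tri_obj[OF tri]
  have U': "U' \<in> add_closure C U"
    and fac: "\<And>W w. \<lbrakk>W \<in> add_closure C U; arr A W w\<rbrakk> \<Longrightarrow> \<exists>v. arr U' W v \<and> w = v \<cdot> f"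
    using approx obj unfolding left_approximation_def arr_def by blast+
  show XU: "Hom_vanishes X (shO C U)"
    using Ext_from_cone_vanishes[OF tri U(1) add_closure_Hom_vanishes[OF U' U(2)]]
      fac[OF add_closure_self[OF U(1)]] by blast
  show UX: "Hom_vanishes U (shO C X)" using Ext_symmetric[OF CY obj(3) U(1) XU] .
  show "Hom_vanishes X (shO C X)"
    unfolding Hom_vanishes_def
  proof (intro allI impI)
    fix \<alpha> assume \<alpha>: "arr X (shO C X) \<alpha>"
    have "\<alpha> \<cdot> g = nul U' (shO C X)"
      using Hom_vanishesD[OF add_closure_Hom_vanishes[OF U' UX]] arr_cmp[OF ar(2) \<alpha>] by blast
    then obtain \<beta> where \<beta>: "arr (shO C A) (shO C X) \<beta>" "\<alpha> = \<beta> \<cdot> h"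
      using tri_extend[OF tri_rotate[OF tri] \<alpha>] by blast
    obtain \<beta>' where \<beta>': "arr A X \<beta>'" "\<beta> = shM C \<beta>'"
      using shift_full[OF \<beta>(1) obj(1,3)] .
    have "h \<cdot> \<beta>' = nul A (shO C A)"
      using Hom_vanishesD[OF A] arr_cmp[OF \<beta>'(1) ar(3)] by blast
    then obtain \<gamma> where \<gamma>: "arr A U' \<gamma>" "\<beta>' = g \<cdot> \<gamma>"
      using tri_lift[OF tri_rotate[OF tri] \<beta>'(1)] by blast
    obtain \<delta> where \<delta>: "arr U' U' \<delta>" "\<gamma> = \<delta> \<cdot> f" using fac[OF U' \<gamma>(1)] by blast
    have g\<delta>: "arr U' X (g \<cdot> \<delta>)" using arr_cmp[OF \<delta>(1) ar(2)] .
    have "\<beta>' = g \<cdot> \<delta> \<cdot> f" using \<gamma>(2) \<delta>(2) assoc[OF ar(1) \<delta>(1) ar(2)] by simp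
    then have "\<alpha> = shM C (g \<cdot> \<delta>) \<cdot> (shM C f \<cdot> h)"
      using \<beta>(2) \<beta>'(2) shift_cmp_arr[OF ar(1) g\<delta>]
        assoc[OF ar(3) shift_arr[OF ar(1)] shift_arr[OF g\<delta>]] by simp
    then show "\<alpha> = nul X (shO C X)"
      using tri_cmp_shift[OF tri] cmp_nul_right[OF shift_arr[OF g\<delta>] obj(3)] by simp
  qed
qed

text \<open>An object \<open>Y\<close> with \<open>Hom(S, Y[1]) = 0\<close> is compared with two approximating triangles, one
  over \<open>add T\<close> and one over \<open>add S\<close>. The connecting map of the second factors through that of the
  first, and this forces it to vanish.\<close>
lemma completion_maximal:
  assumes CY: "Calabi_Yau_2 K C" and fin: "Hom_finite K C" and T: "cluster_tilting C (shO C A)"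
    and tri: "tri C A U' X f g h" and U': "U' \<in> add_closure C U"
    and S: "direct_sum C [U, X] S" "Hom_vanishes S (shO C S)"
    and Y: "Y \<in> Obj C" "Hom_vanishes S (shO C Y)"
  shows "Y \<in> add_closure C S"
proof -
  let ?T = "shO C A"
  note ar = tri_arr[OF tri] and obj = tri_obj[OF tri]
  have Sm: "S \<in> Obj C" "U \<in> add_closure C S" "X \<in> add_closure C S"
    using direct_sum_members[OF S(1)] by auto
  have U'S: "U' \<in> add_closure C S" using add_closure_trans[OF Sm(2,1)] U' by blast
  have TO: "?T \<in> Obj C" and TT: "Hom_vanishes ?T (shO C ?T)"
    and T_max: "\<And>Q. \<lbrakk>Q \<in> Obj C; Hom_vanishes ?T (shO C Q)\<rbrakk> \<Longrightarrow> Q \<in> add_closure C ?T"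
    using T add_closure_self[of ?T] unfolding cluster_tilting_iff by blast+
  have XY: "Hom_vanishes X (shO C Y)" using add_closure_Hom_vanishes[OF Sm(3) Y(2)] .
  \<comment> \<open>The obstruction to lifting a map \<open>Q \<rightarrow> T\<close> along \<open>h\<close> lies in \<open>Hom(Q, U'[1])\<close>. The lift is
    applied to \<open>Y\<close> and, further below, to the cone \<open>Q\<^sub>1\<close>.\<close>
  have lift: "\<exists>w'. arr Q X w' \<and> w = h \<cdot> w'"
    if Q: "Q \<in> Obj C" "Hom_vanishes S (shO C Q)" and w: "arr Q ?T w" for Q w
  proof -
    let ?k = "\<ominus>\<^bsub>Hom C (shO C A) (shO C U')\<^esub> shM C f"
    have "Hom_vanishes Q (shO C U')"
      using Ext_symmetric[OF CY obj(2) Q(1) add_closure_Hom_vanishes[OF U'S Q(2)]] .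
    then have "?k \<cdot> w = nul Q (shO C U')"
      using Hom_vanishesD arr_cmp[OF w arr_neg[OF shift_arr[OF ar(1)]]] by blast
    then show ?thesis using tri_lift[OF tri_rotate[OF tri_rotate[OF tri]] w] by blast
  qed
  obtain m P0 t where P0: "direct_sum C (replicate m ?T) P0" "arr Y P0 t"
      "\<And>u. arr Y ?T u \<Longrightarrow> \<exists>v. arr P0 ?T v \<and> u = v \<cdot> t"
    using power_approximation[OF fin Y(1) TO] by blast
  obtain n P1 s where P1: "direct_sum C (replicate n S) P1" "arr Y P1 s"
      "\<And>u. arr Y S u \<Longrightarrow> \<exists>v. arr P1 S v \<and> u = v \<cdot> s"
    using power_approximation[OF fin Y(1) Sm(1)] by blast
  have P0T: "P0 \<in> add_closure C ?T" and P1S: "P1 \<in> add_closure C S"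
    using direct_sum_replicate_add_closure P0(1) P1(1) TO Sm(1) by blast+
  obtain Q0 g0 h0 where tri0: "tri C Y P0 Q0 t g0 h0" using tri_cone[OF P0(2)] .
  obtain Q1 g1 h1 where tri1: "tri C Y P1 Q1 s g1 h1" using tri_cone[OF P1(2)] .
  note ar0 = tri_arr[OF tri0] and obj0 = tri_obj[OF tri0]
    and ar1 = tri_arr[OF tri1] and obj1 = tri_obj[OF tri1]
  have "Hom_vanishes Q0 (shO C ?T)"
    using Ext_from_cone_vanishes[OF tri0 TO add_closure_Hom_vanishes[OF P0T TT] P0(3)] .
  then have Q0: "Q0 \<in> add_closure C ?T"
    using T_max[OF obj0(3)] Ext_symmetric[OF CY obj0(3) TO] by blast
  have "Hom_vanishes Q1 (shO C S)"
    using Ext_from_cone_vanishes[OF tri1 Sm(1) add_closure_Hom_vanishes[OF P1S S(2)] P1(3)] .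
  then have Q1: "Hom_vanishes S (shO C Q1)" using Ext_symmetric[OF CY obj1(3) Sm(1)] by blast
  have "\<exists>v. arr P1 ?T v \<and> w = v \<cdot> s" if w: "arr Y ?T w" for w
  proof -
    obtain w' where w': "arr Y X w'" "w = h \<cdot> w'" using lift[OF Y w] by blast
    obtain v where v: "arr P1 X v" "w' = v \<cdot> s"
      using add_closure_factors[OF Sm(3) P1(2) w'(1) P1(3)] .
    show ?thesis using w'(2) v assoc[OF P1(2) v(1) ar(3)] arr_cmp[OF v(1) ar(3)] by auto
  qed
  then obtain k where k: "arr P1 P0 k" "t = k \<cdot> s"
    using add_closure_factors[OF P0T P1(2) P0(2)] by blast
  \<comment> \<open>The pair \<open>(id, k)\<close> extends to a morphism of triangles, whose last square expresses \<open>h1\<close>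
    through \<open>h0\<close>.\<close>
  have "k \<cdot> s = t \<cdot> idn C Y" using k(2) cmp_idn_right[OF P0(2)] by simp
  then obtain c where "c \<in> Mor C Q1 Q0" "shM C (idn C Y) \<cdot> h1 = h0 \<cdot> c"
    using TR3[OF tri1 tri0 idn_closed[OF Y(1)] arrD(3)[OF k(1)]] by blast
  then have c: "arr Q1 Q0 c" "h1 = h0 \<cdot> c"
    using obj0 obj1 shift_idn[OF Y(1)] cmp_idn_left[OF ar1(3)] by (auto simp: arr_def)
  have sY: "shO C Y \<in> Obj C" using shift_obj[OF Y(1)] .
  have "h1 \<in> through ?T Q1 (shO C Y)"
    using through_cmp_right[OF sY c(1) through_cmp_left[OF obj0(3) ar0(3) add_closure_through(2)[OF Q0]]]
      c(2) cmp_idn_right[OF ar0(3)] by simp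
  then have "h1 = nul Q1 (shO C Y)"
  proof (rule through_nul[OF obj1(3) sY])
    fix a b assume a: "arr Q1 ?T a" and b: "arr ?T (shO C Y) b"
    obtain a' where a': "arr Q1 X a'" "a = h \<cdot> a'" using lift[OF obj1(3) Q1 a] by blast
    have "b \<cdot> a = b \<cdot> h \<cdot> a'" using a'(2) assoc[OF a'(1) ar(3) b] by simp
    also have "b \<cdot> h = nul X (shO C Y)" using Hom_vanishesD[OF XY arr_cmp[OF ar(3) b]] .
    finally show "b \<cdot> a = nul Q1 (shO C Y)" using cmp_nul_left[OF a'(1) sY] by simp
  qed
  then have "shM C (idn C Y) \<cdot> h1 = nul Q1 (shO C Y)"
    using shift_idn[OF Y(1)] cmp_idn_left[OF ar1(3)] by simp
  then obtain r where "arr P1 Y r" "idn C Y = r \<cdot> s"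
    using tri_extend_shift[OF tri1 arr_idn[OF Y(1)]] by blast
  then have "idn C Y \<in> through S Y Y"
    using retract_through[OF P1(2)] add_closure_through(2)[OF P1S] by simp
  then show ?thesis using add_closure_iff[OF Sm(1)] Y(1) by blast
qed

lemma completion_cluster_tilting:
  assumes CY: "Calabi_Yau_2 K C" and fin: "Hom_finite K C" and T: "cluster_tilting C T"
    and U: "rigid C U" and X: "co_Bongartz_complement C U T X" and S: "direct_sum C [U, X] S"
  shows "cluster_tilting C S"
proof -
  define A where "A = unshift C T"
  have "T \<in> Obj C" using T by (simp add: cluster_tilting_def)
  then have A: "A \<in> Obj C" "shO C A = T" using unshift_obj shift_unshift by (auto simp: A_def)
  obtain U' f g h where tri: "tri C A U' X f g h" and approx: "left_approximation C U A U' f"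
    using X by (auto simp: co_Bongartz_complement_def A_def)
  have UO: "U \<in> Obj C" "Hom_vanishes U (shO C U)"
    using U Hom_vanishes_iff shift_obj by (auto simp: rigid_def)
  have "Hom_vanishes T (shO C T)" using T add_closure_self unfolding cluster_tilting_iff by blast
  then have "Hom_vanishes A (shO C A)"
    using Hom_vanishes_unshift[of A "shO C A"] A shift_obj[OF A(1)] by simp
  note ext = complement_Ext_vanishes[OF CY UO this tri approx]
  have SO: "S \<in> Obj C" using direct_sum_members(1)[OF S] .
  have XO: "X \<in> Obj C" using tri_obj(3)[OF tri] .
  have "Hom_vanishes S (shO C U)" "Hom_vanishes S (shO C X)"
    using UO(2) ext by (auto intro!: Hom_vanishes_direct_sum[OF S])
  then have "Hom_vanishes U (shO C S)" "Hom_vanishes X (shO C S)"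
    using Ext_symmetric[OF CY SO] UO(1) XO by blast+
  then have SS: "Hom_vanishes S (shO C S)" by (auto intro!: Hom_vanishes_direct_sum[OF S])
  have U': "U' \<in> add_closure C U" using approx by (simp add: left_approximation_def)
  have "Y \<in> add_closure C S" if "Y \<in> Obj C" "Hom_vanishes S (shO C Y)" for Y
    using completion_maximal[OF CY fin _ tri U' S SS that] T A by simp
  moreover have "Hom_vanishes S (shO C Y)" if "Y \<in> Obj C" "Y \<in> add_closure C S" for Y
    using Ext_symmetric[OF CY that(1) SO add_closure_Hom_vanishes[OF that(2) SS]] .
  ultimately show ?thesis using SO unfolding cluster_tilting_iff by blast
qed

end

section \<open>Existence of minimal approximations\<close>

context triangulated_linear_category
begin

text \<open>The dimension of \<open>Hom(U, B)\<close>, as the least size of a generating set.\<close>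
definition Hom_rank :: "'o \<Rightarrow> 'o \<Rightarrow> nat"
  where "Hom_rank U B = (LEAST n. \<exists>G. finite G \<and> G \<subseteq> Mor C U B \<and>
    lin_span K (Hom C U B) G = Mor C U B \<and> card G = n)"

lemma Hom_rank_witness:
  assumes "Hom_finite K C" "U \<in> Obj C" "B \<in> Obj C"
  obtains G where "finite G" "G \<subseteq> Mor C U B" "lin_span K (Hom C U B) G = Mor C U B"
    "card G = Hom_rank U B"
proof -
  interpret module K "Hom C U B" using Hom_module assms by blast
  have "\<exists>n G. finite G \<and> G \<subseteq> Mor C U B \<and> lin_span K (Hom C U B) G = Mor C U B \<and> card G = n"
    using finite_dimensional_lin_span assms unfolding Hom_finite_def by metis
  from LeastI_ex[OF this] show thesis using that unfolding Hom_rank_def by blast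
qed

lemma Hom_rank_le:
  assumes "finite G" "G \<subseteq> Mor C U B" "lin_span K (Hom C U B) G = Mor C U B"
  shows "Hom_rank U B \<le> card G"
  unfolding Hom_rank_def using assms by (intro Least_le) blast

text \<open>Since \<open>B\<^sub>1\<close> is a nonzero object of \<open>add U\<close>, there is a nonzero map \<open>U \<rightarrow> B\<^sub>1\<close>; it lies in the
  kernel of the surjection from \<open>Hom(U, B)\<close> to \<open>Hom(U, B\<^sub>2)\<close>.\<close>
lemma Hom_rank_complement_less:
  assumes fin: "Hom_finite K C" and U: "U \<in> Obj C" and b: "biproduct C [B\<^sub>1, B\<^sub>2] B \<iota> \<pi>"
    and B\<^sub>1: "B\<^sub>1 \<in> add_closure C U" "\<not> zero_object C B\<^sub>1"
  shows "Hom_rank U B\<^sub>2 < Hom_rank U B"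
proof -
  have B: "B \<in> Obj C" "B\<^sub>1 \<in> Obj C" "B\<^sub>2 \<in> Obj C"
    using biproductD(1)[OF b] biproductD(2)[OF b, of 0] biproductD(2)[OF b, of 1] by simp_all
  have ar: "arr B\<^sub>1 B (\<iota> 0)" "arr B\<^sub>2 B (\<iota> 1)" "arr B B\<^sub>1 (\<pi> 0)" "arr B B\<^sub>2 (\<pi> 1)"
    using biproductD(3,4)[OF b, of 0] biproductD(3,4)[OF b, of 1] by simp_all
  have id: "\<pi> 0 \<cdot> \<iota> 0 = idn C B\<^sub>1" "\<pi> 1 \<cdot> \<iota> 1 = idn C B\<^sub>2" "\<pi> 1 \<cdot> \<iota> 0 = nul B\<^sub>1 B\<^sub>2"
    using biproductD(5)[OF b, of 0] biproductD(5)[OF b, of 1] biproductD(6)[OF b, of 0 1] by simp_all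
  have "\<not> Hom_vanishes U B\<^sub>1"
    using add_closure_Hom_vanishes[OF B\<^sub>1(1)] Hom_vanishesD[OF _ arr_idn[OF B(2)]] B\<^sub>1(2) B(2)
    by (auto simp: zero_object_iff)
  then obtain x where x: "arr U B\<^sub>1 x" "x \<noteq> nul U B\<^sub>1" by (auto simp: Hom_vanishes_def)
  have \<iota>x: "arr U B (\<iota> 0 \<cdot> x)" using arr_cmp[OF x(1) ar(1)] .
  have "\<pi> 0 \<cdot> (\<iota> 0 \<cdot> x) = x"
    using assoc[OF x(1) ar(1,3)] id(1) cmp_idn_left[OF x(1)] by simp
  then have nz: "\<iota> 0 \<cdot> x \<noteq> nul U B" using x(2) cmp_nul_right[OF ar(3) U] by auto
  have ker: "\<pi> 1 \<cdot> (\<iota> 0 \<cdot> x) = nul U B\<^sub>2"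
    using assoc[OF x(1) ar(1,4)] id(3) cmp_nul_left[OF x(1) B(3)] by simp
  have surj: "Mor C U B\<^sub>2 \<subseteq> (\<lambda>y. \<pi> 1 \<cdot> y) ` Mor C U B"
  proof
    fix y assume "y \<in> Mor C U B\<^sub>2"
    then have y: "arr U B\<^sub>2 y" using U B by (simp add: arr_def)
    have "y = \<pi> 1 \<cdot> (\<iota> 1 \<cdot> y)" using assoc[OF y ar(2,4)] id(2) cmp_idn_left[OF y] by simp
    then show "y \<in> (\<lambda>y. \<pi> 1 \<cdot> y) ` Mor C U B" using arrD(3)[OF arr_cmp[OF y ar(2)]] by blast
  qed
  obtain G where G: "finite G" "G \<subseteq> Mor C U B" "lin_span K (Hom C U B) G = Mor C U B"
      "card G = Hom_rank U B"
    using Hom_rank_witness[OF fin U B(1)] .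
  obtain H where "finite H" "H \<subseteq> Mor C U B\<^sub>2" "lin_span K (Hom C U B\<^sub>2) H = Mor C U B\<^sub>2"
      "card H < card G"
    using module.generators_of_proper_quotient[OF Hom_module[OF U B(1)] field_K Hom_module[OF U B(3)]
      cmp_linear_right[OF U B(1,3) arrD(3)[OF ar(4)]] surj arrD(3)[OF \<iota>x] nz ker G(1-3)] .
  then show ?thesis using Hom_rank_le[of H U B\<^sub>2] G(4) by simp
qed

lemma left_approximation_exists:
  assumes "Hom_finite K C" "A \<in> Obj C" "U \<in> Obj C"
  obtains B f where "left_approximation C U A B f"
proof -
  obtain n P t where P: "direct_sum C (replicate n U) P" "arr A P t"
      "\<And>u. arr A U u \<Longrightarrow> \<exists>v. arr P U v \<and> u = v \<cdot> t"
    using power_approximation[OF assms] by blast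
  have PU: "P \<in> add_closure C U" using direct_sum_replicate_add_closure[OF P(1) assms(3)] .
  have "\<exists>k\<in>Mor C P B. g = k \<cdot> t" if "B \<in> add_closure C U" "g \<in> Mor C A B" for B g
    using add_closure_factors[OF that(1) P(2) arrI[OF assms(2) add_closure_through(1)[OF that(1)] that(2)] P(3)]
      arrD(3) by metis
  then have "left_approximation C U A P t"
    using PU arrD(3)[OF P(2)] by (auto simp: left_approximation_def)
  then show thesis using that by blast
qed

text \<open>If \<open>f\<close> has a summand \<open>0 \<rightarrow> B\<^sub>1\<close>, then it factors through the inclusion of the complement
  \<open>B\<^sub>2\<close>, and the corestriction to \<open>B\<^sub>2\<close> is still universal.\<close>
lemma approximation_remove_zero_summand:
  assumes approx: "left_approximation C U A B f" and U: "U \<in> Obj C" and A: "A \<in> Obj C"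
    and Z: "zero_object C Z" and sum: "morphism_summand C Z B\<^sub>1 (nul Z B\<^sub>1) A B f"
  obtains B\<^sub>2 f\<^sub>2 \<iota> \<pi> where "biproduct C [B\<^sub>1, B\<^sub>2] B \<iota> \<pi>" "left_approximation C U A B\<^sub>2 f\<^sub>2"
proof -
  obtain A\<^sub>2 B\<^sub>2 f\<^sub>2 \<iota>A \<pi>A \<iota> \<pi> where bA: "biproduct C [Z, A\<^sub>2] A \<iota>A \<pi>A"
    and bB: "biproduct C [B\<^sub>1, B\<^sub>2] B \<iota> \<pi>" and f\<^sub>2: "f\<^sub>2 \<in> Mor C A\<^sub>2 B\<^sub>2"
    and f: "f = (\<iota> 0 \<cdot> nul Z B\<^sub>1 \<cdot> \<pi>A 0) \<oplus>\<^bsub>Hom C A B\<^esub> (\<iota> 1 \<cdot> f\<^sub>2 \<cdot> \<pi>A 1)"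
    using sum unfolding morphism_summand_def by blast
  have ar: "arr A Z (\<pi>A 0)" "arr A A\<^sub>2 (\<pi>A 1)" "arr B\<^sub>1 B (\<iota> 0)" "arr B\<^sub>2 B (\<iota> 1)"
    using biproductD(4)[OF bA, of 0] biproductD(4)[OF bA, of 1]
      biproductD(3)[OF bB, of 0] biproductD(3)[OF bB, of 1] by simp_all
  have af\<^sub>2: "arr A\<^sub>2 B\<^sub>2 f\<^sub>2" using f\<^sub>2 ar arrD by (auto intro!: arrI)
  define w where "w = f\<^sub>2 \<cdot> \<pi>A 1"
  have w: "arr A B\<^sub>2 w" unfolding w_def using arr_cmp[OF ar(2) af\<^sub>2] .
  have obj: "Z \<in> Obj C" "B \<in> Obj C" "B\<^sub>1 \<in> Obj C" "B\<^sub>2 \<in> Obj C"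
    using arrD[OF ar(1)] arrD[OF ar(3)] arrD[OF ar(4)] by simp_all
  have "\<iota> 0 \<cdot> nul Z B\<^sub>1 \<cdot> \<pi>A 0 = nul A B"
    using cmp_nul_right[OF ar(3) obj(1)] cmp_nul_left[OF ar(1) obj(2)] by simp
  then have fw: "f = \<iota> 1 \<cdot> w"
    using f nul_add[OF arr_cmp[OF w ar(4)]] assoc[OF ar(2) af\<^sub>2 ar(4)] by (simp add: w_def)
  have "B\<^sub>2 \<in> add_closure C B" using direct_sum_members(2)[of "[B\<^sub>1, B\<^sub>2]" B] bB by (auto simp: direct_sum_def)
  moreover have "B \<in> add_closure C U" using approx by (simp add: left_approximation_def)
  ultimately have B\<^sub>2: "B\<^sub>2 \<in> add_closure C U" using add_closure_trans[OF _ U] by blast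
  have "\<exists>k\<in>Mor C B\<^sub>2 B'. g = k \<cdot> w" if B': "B' \<in> add_closure C U" and g: "g \<in> Mor C A B'" for B' g
  proof -
    obtain k where k: "k \<in> Mor C B B'" "g = k \<cdot> f"
      using approx B' g unfolding left_approximation_def by blast
    then have k': "arr B B' k" using obj add_closure_through(1)[OF B'] by (simp add: arr_def)
    then have "g = k \<cdot> \<iota> 1 \<cdot> w" using k(2) fw assoc[OF w ar(4) k'] by simp
    then show ?thesis using arrD(3)[OF arr_cmp[OF ar(4) k']] by blast
  qed
  then have "left_approximation C U A B\<^sub>2 w"
    using B\<^sub>2 arrD(3)[OF w] by (auto simp: left_approximation_def)
  then show thesis using that bB by blast
qed

lemma left_minimal_approximation_exists:
  assumes fin: "Hom_finite K C" and A: "A \<in> Obj C" and U: "U \<in> Obj C"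
  obtains B f where "left_approximation C U A B f" "left_minimal C A B f"
proof -
  define P where "P n \<longleftrightarrow> (\<exists>B f. left_approximation C U A B f \<and> Hom_rank U B = n)" for n
  have "\<exists>n. P n" unfolding P_def using left_approximation_exists[OF assms] by metis
  then have "P (LEAST n. P n)" by (rule LeastI_ex)
  then obtain B f where Bf: "left_approximation C U A B f" "Hom_rank U B = (LEAST n. P n)"
    unfolding P_def by blast
  have "False" if summand: "zero_object C Z" "\<not> zero_object C B\<^sub>1" "morphism_summand C Z B\<^sub>1 (nul Z B\<^sub>1) A B f"
    for Z B\<^sub>1
  proof -
    obtain B\<^sub>2 f\<^sub>2 \<iota> \<pi> where b: "biproduct C [B\<^sub>1, B\<^sub>2] B \<iota> \<pi>" "left_approximation C U A B\<^sub>2 f\<^sub>2"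
      using approximation_remove_zero_summand[OF Bf(1) U A summand(1,3)] .
    have "B \<in> add_closure C U" using Bf(1) by (simp add: left_approximation_def)
    moreover have "B\<^sub>1 \<in> add_closure C B"
      using direct_sum_members(2)[of "[B\<^sub>1, B\<^sub>2]" B] b(1) by (auto simp: direct_sum_def)
    ultimately have "B\<^sub>1 \<in> add_closure C U" using add_closure_trans[OF _ U] by blast
    then have "Hom_rank U B\<^sub>2 < (LEAST n. P n)"
      using Hom_rank_complement_less[OF fin U b(1) _ summand(2)] Bf(2) by simp
    moreover have "P (Hom_rank U B\<^sub>2)" using b(2) by (auto simp: P_def)
    ultimately show False using not_less_Least by blast
  qed
  then have "left_minimal C A B f" unfolding left_minimal_def by blast
  then show thesis using that Bf(1) by blast
qed

section \<open>Basic versions in a Krull-Schmidt category\<close>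

lemma isomorphic_sym: "isomorphic C X Y \<Longrightarrow> isomorphic C Y X"
  unfolding isomorphic_def isomorphism_def by blast

lemma isomorphic_add_closure:
  assumes "isomorphic C X Y" "X \<in> Obj C" "Y \<in> Obj C"
  shows "X \<in> add_closure C Y"
proof -
  obtain f g where "arr X Y f" "arr Y X g" "g \<cdot> f = idn C X"
    using assms by (auto simp: isomorphic_def isomorphism_def arr_def)
  then have "idn C X \<in> through Y X X" using through_single by metis
  then show ?thesis using assms by (simp add: add_closure_iff)
qed

lemma pairwise_nonisomorphic_representatives:
  assumes "set Xs \<subseteq> Obj C"
  obtains Ys where "set Ys \<subseteq> set Xs" "\<And>X. X \<in> set Xs \<Longrightarrow> \<exists>Y\<in>set Ys. isomorphic C X Y"
    "\<And>i j. \<lbrakk>i < length Ys; j < length Ys; i \<noteq> j\<rbrakk> \<Longrightarrow> \<not> isomorphic C (Ys ! i) (Ys ! j)"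
proof -
  have "\<exists>Ys. set Ys \<subseteq> set Xs \<and> (\<forall>X\<in>set Xs. \<exists>Y\<in>set Ys. isomorphic C X Y) \<and>
      sorted_wrt (\<lambda>X Y. \<not> isomorphic C X Y) Ys"
    using assms
  proof (induction Xs)
    case (Cons X Xs)
    then obtain Ys where Ys: "set Ys \<subseteq> set Xs" "\<forall>X\<in>set Xs. \<exists>Y\<in>set Ys. isomorphic C X Y"
        "sorted_wrt (\<lambda>X Y. \<not> isomorphic C X Y) Ys" by auto
    have "isomorphic C X X"
      using Cons.prems idn_closed[of X] idn_left[of X X "idn C X"]
      unfolding isomorphic_def isomorphism_def by auto
    show ?case
    proof (cases "\<exists>Y\<in>set Ys. isomorphic C X Y")
      case True
      then show ?thesis using Ys by (intro exI[of _ Ys]) auto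
    next
      case False
      then show ?thesis using Ys \<open>isomorphic C X X\<close> by (intro exI[of _ "X # Ys"]) auto
    qed
  qed auto
  then obtain Ys where Ys: "set Ys \<subseteq> set Xs" "\<forall>X\<in>set Xs. \<exists>Y\<in>set Ys. isomorphic C X Y"
      "sorted_wrt (\<lambda>X Y. \<not> isomorphic C X Y) Ys" by blast
  have "\<not> isomorphic C (Ys ! i) (Ys ! j)" if "i < length Ys" "j < length Ys" "i \<noteq> j" for i j
    using sorted_wrt_nth_less[OF Ys(3), of i j] sorted_wrt_nth_less[OF Ys(3), of j i] that
      isomorphic_sym by (cases i j rule: linorder_cases) auto
  then show thesis using that Ys by blast
qed

text \<open>For a decomposition into \<open>Y\<close> and \<open>Z\<close>, the two idempotents add up to the identity, so one
  of them is invertible; being orthogonal to the other, it forces the other summand to be zero.\<close>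
lemma local_End_indecomposable:
  assumes loc: "local_ring (End_ring C X)" and X: "X \<in> Obj C"
  shows "indecomposable C X"
proof -
  have E: "carrier (End_ring C X) = Mor C X X" "\<one>\<^bsub>End_ring C X\<^esub> = idn C X"
      "\<zero>\<^bsub>End_ring C X\<^esub> = nul X X" "mult (End_ring C X) = cmp C"
      "add (End_ring C X) = add (Hom C X X)"
    by (simp_all add: End_ring_def)
  have nz: "\<not> zero_object C X" using loc by (simp add: local_ring_def E zero_object_iff)
  have "zero_object C Y \<or> zero_object C Z" if YZ: "direct_sum C [Y, Z] X" for Y Z
  proof -
    obtain \<iota> \<pi> where b: "biproduct C [Y, Z] X \<iota> \<pi>" using YZ by (auto simp: direct_sum_def)
    have kill: "zero_object C ([Y, Z] ! j)"
      if u: "\<iota> i \<cdot> \<pi> i \<in> Units (End_ring C X)" and ij: "i < 2" "j < 2" "i \<noteq> j" for i j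
    proof -
      let ?A = "[Y, Z] ! i" and ?B = "[Y, Z] ! j"
      have ar: "arr ?A X (\<iota> i)" "arr X ?A (\<pi> i)" "arr ?B X (\<iota> j)" "arr X ?B (\<pi> j)"
        and ij0: "\<pi> i \<cdot> \<iota> j = nul ?B ?A" and jj: "\<pi> j \<cdot> \<iota> j = idn C ?B"
        using biproductD(3-5)[OF b, of i] biproductD(3-5)[OF b, of j] biproductD(6)[OF b, of j i] ij
        by simp_all
      have B: "?B \<in> Obj C" using arrD(1)[OF ar(3)] .
      obtain w where w: "arr X X w" "w \<cdot> (\<iota> i \<cdot> \<pi> i) = idn C X"
        using u X by (auto simp: Units_def E arr_def)
      have "\<iota> j = w \<cdot> (\<iota> i \<cdot> \<pi> i) \<cdot> \<iota> j" using w cmp_idn_left[OF ar(3)] by simp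
      also have "\<dots> = w \<cdot> (\<iota> i \<cdot> (\<pi> i \<cdot> \<iota> j))"
        using assoc[OF ar(3) arr_cmp[OF ar(2,1)] w(1)] assoc[OF ar(3,2,1)] by simp
      also have "\<dots> = nul ?B X"
        using ij0 cmp_nul_right[OF ar(1) B] cmp_nul_right[OF w(1) B] by simp
      finally have "idn C ?B = nul ?B ?B" using jj cmp_nul_right[OF ar(4) B] by simp
      then show ?thesis using B by (simp add: zero_object_iff)
    qed
    have ee: "arr X X (\<iota> 0 \<cdot> \<pi> 0)" "arr X X (\<iota> 1 \<cdot> \<pi> 1)"
      using arr_cmp[OF biproductD(4,3)[OF b], of 0] arr_cmp[OF biproductD(4,3)[OF b], of 1] by simp_all
    interpret ring "End_ring C X" using loc by (simp add: local_ring_def)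
    interpret M: abelian_group "Hom C X X" using Hom_abelian_group[OF X X] .
    have "{..<length [Y, Z]} = {0, 1}" by auto
    then have "\<iota> 0 \<cdot> \<pi> 0 \<oplus>\<^bsub>Hom C X X\<^esub> \<iota> 1 \<cdot> \<pi> 1 = idn C X"
      using biproductD(7)[OF b] arrD(3)[OF ee(1)] arrD(3)[OF ee(2)] M.finsum_insert[of "{1::nat}" 0 "\<lambda>i. \<iota> i \<cdot> \<pi> i"]
        M.finsum_insert[of "{}" "1::nat" "\<lambda>i. \<iota> i \<cdot> \<pi> i"] by simp
    then have "\<iota> 0 \<cdot> \<pi> 0 \<oplus>\<^bsub>End_ring C X\<^esub> \<iota> 1 \<cdot> \<pi> 1 \<in> Units (End_ring C X)"
      using Units_one_closed by (simp add: E)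
    then have "\<iota> 0 \<cdot> \<pi> 0 \<in> Units (End_ring C X) \<or> \<iota> 1 \<cdot> \<pi> 1 \<in> Units (End_ring C X)"
      using loc arrD(3)[OF ee(1)] arrD(3)[OF ee(2)] unfolding local_ring_def E(1) by blast
    then show ?thesis using kill[of 0 1] kill[of 1 0] by auto
  qed
  then show ?thesis using X nz by (simp add: indecomposable_def)
qed

text \<open>Keep one representative of each isomorphism class of summands. Both direct sums lie in the
  additive closure of the other, as isomorphic objects lie in each other's additive closure.\<close>
lemma basic_version_exists:
  assumes "Krull_Schmidt C" "S \<in> Obj C"
  obtains V where "basic_version C S V"
proof -
  obtain Xs where Xs: "direct_sum C Xs S" "\<And>X. X \<in> set Xs \<Longrightarrow> local_ring (End_ring C X)"
    using assms by (auto simp: Krull_Schmidt_def)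
  have XS: "set Xs \<subseteq> add_closure C S" using direct_sum_members(2)[OF Xs(1)] .
  then have XO: "set Xs \<subseteq> Obj C" using add_closure_through(1) by blast
  obtain Ys where Ys: "set Ys \<subseteq> set Xs" "\<And>X. X \<in> set Xs \<Longrightarrow> \<exists>Y\<in>set Ys. isomorphic C X Y"
    "\<And>i j. \<lbrakk>i < length Ys; j < length Ys; i \<noteq> j\<rbrakk> \<Longrightarrow> \<not> isomorphic C (Ys ! i) (Ys ! j)"
    using pairwise_nonisomorphic_representatives[OF XO] by blast
  obtain V where V: "direct_sum C Ys V" using direct_sum_exists[of Ys] Ys(1) XO by blast
  have VO: "V \<in> Obj C" and YV: "set Ys \<subseteq> add_closure C V" using direct_sum_members[OF V] by blast+
  have "basic_decomposition C Ys V"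
    unfolding basic_decomposition_def using V Ys(1,3) Xs(2) XO local_End_indecomposable by blast
  moreover have "X \<in> add_closure C V" if X: "X \<in> set Xs" for X
  proof -
    obtain Y where Y: "Y \<in> set Ys" "isomorphic C X Y" using Ys(2)[OF X] by blast
    then have "X \<in> add_closure C Y" using isomorphic_add_closure X XO Ys(1) by blast
    then show ?thesis using add_closure_trans[OF _ VO] Y(1) YV by blast
  qed
  then have "S \<in> add_closure C V" using add_closure_direct_sum[OF Xs(1) _ VO] by blast
  moreover have "V \<in> add_closure C S" using add_closure_direct_sum[OF V _ assms(2)] Ys(1) XS by blast
  ultimately have "basic_version C S V"
    using add_closure_trans VO assms(2) unfolding basic_version_def basic_def by blast
  then show thesis using that by blast
qed

lemma basic_in_Obj: "basic C V \<Longrightarrow> V \<in> Obj C"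
  using direct_sum_members(1) by (auto simp: basic_def basic_decomposition_def)

end

theorem theorem4p1p2:
  fixes K :: "'k ring" and C :: "('k, 'o, 'm) tri_cat" and Ts :: "'o list" and T U :: 'o
  assumes "triangulated_linear_category K C"
    and "Krull_Schmidt C"
    and "Hom_finite K C"
    and "Calabi_Yau_2 K C"
    and "basic_decomposition C Ts T"
    and "cluster_tilting C T"
    and "rigid C U"
  shows "(\<exists>V. co_Bongartz_completion C U T V) \<and>
    (\<forall>V. co_Bongartz_completion C U T V \<longrightarrow> basic C V \<and> cluster_tilting C V)"
proof (intro conjI allI impI)
  interpret triangulated_linear_category K C by fact
  have U: "U \<in> Obj C" and A: "unshift C T \<in> Obj C"
    using assms(6,7) unshift_obj by (auto simp: rigid_def cluster_tilting_def)
  obtain U' f where f: "left_approximation C U (unshift C T) U' f" "left_minimal C (unshift C T) U' f"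
    using left_minimal_approximation_exists[OF assms(3) A U] .
  then have "arr (unshift C T) U' f"
    using A add_closure_through(1) by (auto simp: left_approximation_def intro!: arrI)
  then obtain X g h where tri: "tri C (unshift C T) U' X f g h" by (rule tri_cone)
  then have X: "co_Bongartz_complement C U T X" "X \<in> Obj C"
    using f tri_obj(3) by (auto simp: co_Bongartz_complement_def)
  obtain S where S: "direct_sum C [U, X] S" using direct_sum_exists[of "[U, X]"] U X by auto
  obtain V where "basic_version C S V"
    using basic_version_exists[OF assms(2) direct_sum_members(1)[OF S]] .
  then show "\<exists>V. co_Bongartz_completion C U T V"
    using X(1) S by (auto simp: co_Bongartz_completion_def)
next
  interpret triangulated_linear_category K C by fact
  fix V assume "co_Bongartz_completion C U T V"
  then obtain X S where *: "co_Bongartz_complement C U T X" "direct_sum C [U, X] S"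
      "basic_version C S V"
    by (auto simp: co_Bongartz_completion_def)
  then show basic: "basic C V" by (simp add: basic_version_def)
  show "cluster_tilting C V"
    using cluster_tilting_cong[OF completion_cluster_tilting[OF assms(4,3,6,7) *(1,2)] basic_in_Obj[OF basic]]
      *(3) by (simp add: basic_version_def)
qed

end
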